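(* Let $\mathcal{H}$ be a finite-dimensional Hilbert space, let $G_1,\ldots,G_J$ be Hermitian operators on $\mathcal{H}$, and for $\theta=(\theta_1,\ldots,\theta_J)\in\mathbb{R}^J$ let $G(\theta)=\sum_{j=1}^J\theta_j G_j$ and $\rho(\theta)=e^{-G(\theta)}/\operatorname{Tr}[e^{-G(\theta)}]$. Then for all $i,j\in\{1,\ldots,J\}$ the Fisher--Bures information matrix of the family $(\rho(\theta))_{\theta\in\mathbb{R}^J}$ satisfies $$I^{\mathrm{FB}}_{ij}(\theta)=\tfrac12\operatorname{Tr}\big[\{\Phi_\theta(G_i),\Phi_\theta(G_j)\}\rho(\theta)\big]-\operatorname{Tr}[G_i\rho(\theta)]\operatorname{Tr}[G_j\rho(\theta)],$$ where $\{A,B\}=AB+BA$. Equivalently, $I^{\mathrm{FB}}_{ij}(\theta)=\operatorname{Re}\operatorname{Tr}[\Phi_\theta(G_i)\rho(\theta)\Phi_\theta(G_j)]-\operatorname{Tr}[G_i\rho(\theta)]\operatorname{Tr}[G_j\rho(\theta)]$.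
   Context: The "high-peak tent" probability density on $\mathbb{R}$ is $p(t)=\frac{2}{\pi}\ln|\coth(\pi t/2)|$. The quantum channel $\Phi_\theta$ is defined on operators $X$ on $\mathcal{H}$ by $\Phi_\theta(X)=\int_{\mathbb{R}}dt\,p(t)\,e^{-iG(\theta)t}Xe^{iG(\theta)t}$. For a differentiable family $(\sigma(\theta))_{\theta\in\mathbb{R}^J}$ of positive-definite density operators with spectral decomposition $\sigma(\theta)=\sum_k\lambda_k|k\rangle\langle k|$ (eigenvalues and eigenvectors depending on $\theta$), the Fisher--Bures information matrix is $I^{\mathrm{FB}}_{ij}(\theta)=\sum_{k,\ell}\frac{2}{\lambda_k+\lambda_\ell}\langle k|\partial_i\sigma(\theta)|\ell\rangle\langle\ell|\partial_j\sigma(\theta)|k\rangle$, where $\partial_i=\partial/\partial\theta_i$. *)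

theory Defs
  imports "HOL-Analysis.Analysis"
begin

type_synonym 'n cmat = "complex^'n^'n"

primrec mpow :: "'n::finite cmat \<Rightarrow> nat \<Rightarrow> 'n cmat" where
  "mpow A 0 = mat 1"
| "mpow A (Suc k) = A ** mpow A k"

definition mexp :: "'n::finite cmat \<Rightarrow> 'n cmat" where
  "mexp A = (\<Sum>k. (1 / fact k) *\<^sub>R mpow A k)"

definition cscale :: "complex \<Rightarrow> 'n::finite cmat \<Rightarrow> 'n cmat" where
  "cscale c A = (\<chi> a b. c * A$a$b)"

definition cadj :: "'n::finite cmat \<Rightarrow> 'n cmat" where
  "cadj A = (\<chi> a b. cnj (A$b$a))"

definition hermitian :: "'n::finite cmat \<Rightarrow> bool" where
  "hermitian A \<longleftrightarrow> cadj A = A"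

definition braket :: "complex^'n \<Rightarrow> 'n::finite cmat \<Rightarrow> complex^'n \<Rightarrow> complex" where
  "braket u X w = (\<Sum>a\<in>UNIV. cnj (u$a) * (X *v w)$a)"

definition Gen :: "('j::finite \<Rightarrow> 'n::finite cmat) \<Rightarrow> real^'j \<Rightarrow> 'n cmat" where
  "Gen G \<theta> = (\<Sum>j\<in>UNIV. cscale (complex_of_real (\<theta>$j)) (G j))"

definition gibbs :: "('j::finite \<Rightarrow> 'n::finite cmat) \<Rightarrow> real^'j \<Rightarrow> 'n cmat" where
  "gibbs G \<theta> = cscale (1 / trace (mexp (- Gen G \<theta>))) (mexp (- Gen G \<theta>))"

definition coth :: "real \<Rightarrow> real" where
  "coth x = cosh x / sinh x"

definition tent :: "real \<Rightarrow> real" where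
  "tent t = 2 / pi * ln \<bar>coth (pi * t / 2)\<bar>"

definition Phi :: "('j::finite \<Rightarrow> 'n::finite cmat) \<Rightarrow> real^'j \<Rightarrow> 'n cmat \<Rightarrow> 'n cmat" where
  "Phi G \<theta> X = (\<chi> a b. integral\<^sup>L lborel (\<lambda>t::real.
      complex_of_real (tent t) *
      (mexp (cscale (- \<i> * complex_of_real t) (Gen G \<theta>)) ** X **
       mexp (cscale (\<i> * complex_of_real t) (Gen G \<theta>)))$a$b))"

definition pderiv_mat :: "(real^'j::finite \<Rightarrow> 'n::finite cmat) \<Rightarrow> 'j \<Rightarrow> real^'j \<Rightarrow> 'n cmat" where
  "pderiv_mat \<sigma> i \<theta> = (\<chi> a b. vector_derivative (\<lambda>s::real. \<sigma> (\<theta> + s *\<^sub>R axis i 1)$a$b) (at 0))"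

definition spectral_decomp :: "'n::finite cmat \<Rightarrow> ('n \<Rightarrow> complex^'n) \<Rightarrow> ('n \<Rightarrow> real) \<Rightarrow> bool" where
  "spectral_decomp \<sigma> v lam \<longleftrightarrow>
     (\<forall>k l. braket (v k) (mat 1) (v l) = (if k = l then 1 else 0)) \<and>
     \<sigma> = (\<Sum>k\<in>UNIV. cscale (complex_of_real (lam k)) (\<chi> a b. v k $ a * cnj (v k $ b)))"

text \<open>Fisher--Bures information matrix at \<theta>, computed from a spectral decomposition (v,\<lambda>) of \<sigma>(\<theta>).\<close>
definition FB_info :: "(real^'j::finite \<Rightarrow> 'n::finite cmat) \<Rightarrow> real^'j \<Rightarrow> ('n \<Rightarrow> complex^'n) \<Rightarrow> ('n \<Rightarrow> real) \<Rightarrow> 'j \<Rightarrow> 'j \<Rightarrow> complex" where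
  "FB_info \<sigma> \<theta> v lam i j = (\<Sum>k\<in>UNIV. \<Sum>l\<in>UNIV.
      complex_of_real (2 / (lam k + lam l)) *
      braket (v k) (pderiv_mat \<sigma> i \<theta>) (v l) * braket (v l) (pderiv_mat \<sigma> j \<theta>) (v k))"

end

theory Submission
  imports Defs
begin

text \<open>In an orthonormal eigenbasis of the Gibbs state, with energies \<open>h\<^sub>k\<close>, everything is explicit.  Duhamel's
formula expresses \<open>\<partial>\<^sub>i\<rho>\<close> through the divided differences of \<open>exp\<close> at \<open>-h\<^sub>k, -h\<^sub>l\<close>, and \<open>\<Phi>\<^sub>\<theta>\<close> multiplies
matrix entries by the Fourier transform of the tent density at \<open>h\<^sub>k - h\<^sub>l\<close>.  That transform is
\<open>tanh (\<omega>/2) / (\<omega>/2)\<close>, which is exactly the ratio of the divided difference to the mean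
\<open>(\<lambda>\<^sub>k + \<lambda>\<^sub>l) / 2\<close>; hence \<open>\<langle>k|\<partial>\<^sub>i\<rho>|l\<rangle> = - (\<lambda>\<^sub>k + \<lambda>\<^sub>l) / 2 \<langle>k|\<Phi>\<^sub>\<theta>(G\<^sub>i)|l\<rangle> + \<delta>\<^sub>k\<^sub>l \<lambda>\<^sub>k Tr[G\<^sub>i \<rho>]\<close> and the
Fisher--Bures sum collapses.  The transform itself follows from the expansion of \<open>ln coth\<close> into
exponentials and the partial fractions of \<open>tanh\<close>.  No spectral theorem is needed: the given eigenbasis of
\<open>\<rho>\<close> also diagonalises \<open>G(\<theta>)\<close>.\<close>

subsection \<open>The Fourier transform of the tent density\<close>

text \<open>With \<open>y\<close> = exp(-pi |t|), coth(pi |t| / 2) is (1 + y) / (1 - y), whose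
  logarithm is twice the odd part of the power series of -ln(1 - y). At \<open>t = 0\<close> the
  series diverges, so later uses hold only almost everywhere.\<close>

lemma tent_sums:
  assumes "t \<noteq> 0"
  shows "(\<lambda>k. 4 / pi * exp (- (real (2 * k + 1) * pi * \<bar>t\<bar>)) / real (2 * k + 1)) sums tent t"
proof -
  define y where "y = exp (- (pi * \<bar>t\<bar>))"
  have y: "0 < y" "y < 1" using assms by (auto simp: y_def)
  have coth_abs: "\<bar>coth (pi * t / 2)\<bar> = coth (pi * \<bar>t\<bar> / 2)"
  proof (cases "t \<ge> 0")
    case True
    then show ?thesis by (auto simp: coth_def)
  next
    case False
    then have "coth (pi * t / 2) = - coth (pi * \<bar>t\<bar> / 2)" by (simp add: coth_def)
    moreover have "coth (pi * \<bar>t\<bar> / 2) \<ge> 0" unfolding coth_def by simp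
    ultimately show ?thesis by simp
  qed
  define e where "e = exp (pi * \<bar>t\<bar> / 2)"
  have e: "e > 1" using assms by (auto simp: e_def)
  have y_e: "y = 1 / e\<^sup>2"
    unfolding y_def e_def by (simp add: exp_minus field_simps flip: exp_double)
  have coth_y: "coth (pi * \<bar>t\<bar> / 2) = (1 + y) / (1 - y)"
  proof -
    have "coth (pi * \<bar>t\<bar> / 2) = (e + 1 / e) / (e - 1 / e)"
    proof -
      have "(a / 2) / (b / 2) = a / b" for a b :: real by simp
      then show ?thesis
        unfolding coth_def cosh_field_def sinh_field_def exp_minus inverse_eq_divide e_def .
    qed
    also have "\<dots> = (e\<^sup>2 + 1) / (e\<^sup>2 - 1)"
      using e mult_divide_mult_cancel_left[of e "e + 1 / e" "e - 1 / e"]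
      by (simp add: algebra_simps power2_eq_square)
    also have "\<dots> = (1 + y) / (1 - y)"
      using e y mult_divide_mult_cancel_left[of "e\<^sup>2" "1 + y" "1 - y"] by (simp add: y_e algebra_simps)
    finally show ?thesis .
  qed
  \<comment> \<open>Chosen so that the argument (x - 1) / (x + 1) of
    \<open>ln_series_quadratic\<close> is \<open>y\<close>.\<close>
  define x where "x = (1 + y) / (1 - y)"
  have x: "x > 0" "(x - 1) / (x + 1) = y"
    using y by (auto simp: x_def field_simps)
  have "(\<lambda>k. 2 / pi * (2 * y ^ (2 * k + 1) / real (2 * k + 1))) sums (2 / pi * ln x)"
    using sums_mult[OF ln_series_quadratic[OF x(1)], of "2 / pi"] unfolding x(2) by simp
  moreover have "y ^ m = exp (- (real m * pi * \<bar>t\<bar>))" for m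
    by (simp add: y_def mult_ac flip: exp_of_nat_mult)
  then have "2 / pi * (2 * y ^ (2 * k + 1) / real (2 * k + 1)) =
      4 / pi * exp (- (real (2 * k + 1) * pi * \<bar>t\<bar>)) / real (2 * k + 1)" for k
    unfolding \<open>y ^ (2 * k + 1) = _\<close> by (simp only: mult_ac times_divide_eq_left times_divide_eq_right)
  ultimately show ?thesis
    unfolding tent_def coth_abs coth_y x_def by (simp only:)
qed

text \<open>The antiderivative is -exp(-z t) / z, which vanishes at infinity because
  \<open>Re z > 0\<close>. Integrability has to be settled first, through the modulus exp(-Re z
  t).\<close>

lemma has_bochner_integral_exp_atLeast0:
  fixes z :: complex
  assumes "Re z > 0"
  shows "has_bochner_integral lborel (\<lambda>t::real. indicator {0<..} t *\<^sub>R exp (- z * of_real t)) (1 / z)"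
proof -
  let ?f = "\<lambda>t::real. exp (- z * of_real t)"
  have ei: "einterval 0 \<infinity> = {0<..}"
    by (auto simp: einterval_def)
  have z: "z \<noteq> 0" using assms by auto
  have lim: "((\<lambda>t. exp (- (Re z * t))) \<longlongrightarrow> 0) at_top"
    using assms by (intro filterlim_compose[OF exp_at_bot] filterlim_uminus_at_top[THEN iffD1]
      filterlim_tendsto_pos_mult_at_top[OF tendsto_const]) (auto intro: filterlim_ident)
  have lim1: "((\<lambda>t. - exp (- (Re z * t)) / Re z) \<longlongrightarrow> 0) at_top"
    using tendsto_mult_right[OF lim, of "- 1 / Re z"] by (simp add: mult_ac)
  \<comment> \<open>For a nonnegative integrand the fundamental theorem yields integrability from
    the limits of the antiderivative alone; the complex integrand is then dominated by it.\<close>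
  have "set_integrable lborel (einterval 0 \<infinity>) (\<lambda>t. exp (- (Re z * t)))"
    by (rule interval_integral_FTC_nonneg(1)[where F = "\<lambda>t. - exp (- (Re z * t)) / Re z" and B = 0 and A = "- 1 / Re z"])
      (use assms lim1 in \<open>auto intro!: derivative_eq_intros tendsto_eq_intros
        simp: ereal_tendsto_simps zero_ereal_def\<close>)
  then have int: "set_integrable lborel (einterval 0 \<infinity>) ?f"
    unfolding set_integrable_def
    by (rule Bochner_Integration.integrable_bound)
      (auto intro!: AE_I2 simp: norm_exp indicator_def)
  have limz: "((\<lambda>t. - ?f t / z) \<longlongrightarrow> 0) at_top"
  proof (rule tendsto_norm_zero_cancel)
    have "norm (- ?f t / z) = exp (- (Re z * t)) / norm z" for t
      by (simp add: norm_divide)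
    moreover have "((\<lambda>t. exp (- (Re z * t)) / norm z) \<longlongrightarrow> 0) at_top"
      using tendsto_divide[OF lim tendsto_const, of "norm z"] z by simp
    ultimately show "((\<lambda>t. norm (- ?f t / z)) \<longlongrightarrow> 0) at_top"
      by simp
  qed
  have "(LBINT t=0..\<infinity>. ?f t) = 0 - (- 1 / z)"
  proof (rule interval_integral_FTC_integrable[where F = "\<lambda>t. - ?f t / z"])
    show "((\<lambda>t. - ?f t / z) has_vector_derivative ?f t) (at t)" for t
      using z by (auto intro!: derivative_eq_intros has_vector_derivative_real_field)
  qed (use int limz z in \<open>auto intro!: continuous_intros tendsto_eq_intros
        simp: ereal_tendsto_simps zero_ereal_def\<close>)
  moreover have "(LBINT t=0..\<infinity>. ?f t) = integral\<^sup>L lborel (\<lambda>t. indicator {0<..} t *\<^sub>R ?f t)"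
    unfolding interval_lebesgue_integral_def ei by (simp add: set_lebesgue_integral_def)
  ultimately show ?thesis
    using int unfolding ei set_integrable_def
    by (simp add: has_bochner_integral_iff)
qed

text \<open>Splitting at 0 and reflecting the negative half-line gives 1/z + 1/cnj z with z = c + i
  w.\<close>

lemma has_bochner_integral_exp_abs:
  fixes c w :: real
  assumes "c > 0"
  shows "has_bochner_integral lborel (\<lambda>t::real. of_real (exp (- c * \<bar>t\<bar>)) * exp (- \<i> * of_real (w * t)))
     (complex_of_real (2 * c / (c\<^sup>2 + w\<^sup>2)))"
proof -
  define z where "z = Complex c w"
  let ?g = "\<lambda>z t. indicator {0<..} t *\<^sub>R exp (- z * complex_of_real t)"
  have 1: "has_bochner_integral lborel (?g z) (1 / z)"
    by (rule has_bochner_integral_exp_atLeast0) (use assms in \<open>simp add: z_def\<close>)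
  have "has_bochner_integral lborel (?g (cnj z)) (1 / cnj z)"
    by (rule has_bochner_integral_exp_atLeast0) (use assms in \<open>simp add: z_def\<close>)
  then have 2: "has_bochner_integral lborel (\<lambda>t. ?g (cnj z) (- t)) (1 / cnj z)"
    using lborel_has_bochner_integral_real_affine_iff[of "-1" "?g (cnj z)" _ 0] by simp
  \<comment> \<open>At 0 both indicators vanish, so the two sides agree only off that point.\<close>
  have eq: "AE t in lborel. ?g z t + ?g (cnj z) (- t) =
      of_real (exp (- c * \<bar>t\<bar>)) * exp (- \<i> * of_real (w * t))"
    using AE_lborel_singleton[of "0::real"]
  proof eventually_elim
    case (elim t)
    have "exp (- z * of_real t) = of_real (exp (- c * t)) * exp (- \<i> * of_real (w * t))"
      by (simp add: z_def complex_eq_iff Re_exp Im_exp exp_of_real[symmetric] flip: exp_add)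
    moreover have "exp (- cnj z * of_real (- t)) = of_real (exp (- c * - t)) * exp (- \<i> * of_real (w * t))"
      by (simp add: z_def complex_eq_iff Re_exp Im_exp exp_of_real[symmetric] flip: exp_add)
    ultimately show ?case using elim by (auto simp: indicator_def abs_if)
  qed
  have "1 / z + 1 / cnj z = of_real (2 * c / (c\<^sup>2 + w\<^sup>2))"
    by (simp add: complex_eq_iff z_def Re_divide Im_divide power2_eq_square)
  moreover have "has_bochner_integral lborel (\<lambda>t. ?g z t + ?g (cnj z) (- t)) (1 / z + 1 / cnj z)"
    by (rule has_bochner_integral_add[OF 1 2])
  ultimately show ?thesis
    using eq by (subst (asm) has_bochner_integral_cong_AE[OF _ _ eq]) auto
qed

text \<open>The logarithmic derivative of the reflection formula for \<open>\<Gamma>\<close> at \<open>1/2 + \<i> y\<close>.\<close>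

lemma tanh_partial_fractions:
  fixes y :: real
  shows "(\<lambda>k. 2 * y / ((real k + 1/2)\<^sup>2 + y\<^sup>2)) sums (pi * tanh (pi * y))"
proof -
  define z where "z = Complex (1/2) y"
  have nz: "z \<noteq> 0" "1 - z \<noteq> 0" by (auto simp: z_def complex_eq_iff)
  have ni: "z \<notin> \<int>\<^sub>\<le>\<^sub>0" "1 - z \<notin> \<int>\<^sub>\<le>\<^sub>0"
    by (auto simp: z_def elim!: nonpos_Ints_cases simp: complex_eq_iff)
  \<comment> \<open>The same derivative is computed by the product rule and, in the next fact, from
    the reflection formula; comparing the two determines Digamma(1 - z) - Digamma z.\<close>
  have 1: "((\<lambda>z. rGamma z * rGamma (1 - z)) has_field_derivative
      (- rGamma z * Digamma z) * rGamma (1 - z) + rGamma z * (rGamma (1 - z) * Digamma (1 - z))) (at z)"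
    using ni by (auto intro!: derivative_eq_intros simp: algebra_simps)
  have 2: "((\<lambda>z. rGamma z * rGamma (1 - z)) has_field_derivative cos (of_real pi * z)) (at z)"
    unfolding rGamma_reflection_complex by (auto intro!: derivative_eq_intros)
  have "sin (of_real pi * z) / of_real pi * (Digamma (1 - z) - Digamma z) = cos (of_real pi * z)"
    using DERIV_unique[OF 1 2] unfolding rGamma_reflection_complex[symmetric]
    by (simp add: algebra_simps)
  moreover have sz: "sin (of_real pi * z) = cosh (of_real (pi * y))"
  proof -
    have "of_real pi * z = of_real pi / 2 + \<i> * of_real (pi * y)"
      by (simp add: z_def complex_eq_iff)
    then show ?thesis by (simp add: sin_add cosh_conv_cos cos_of_real_pi_half sin_of_real_pi_half)
  qed
  moreover have "cos (of_real pi * z) = - \<i> * sinh (of_real (pi * y))"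
  proof -
    have "of_real pi * z = of_real pi / 2 + \<i> * of_real (pi * y)"
      by (simp add: z_def complex_eq_iff)
    then show ?thesis by (simp add: cos_add sinh_conv_sin cos_of_real_pi_half sin_of_real_pi_half)
  qed
  moreover have "cosh (complex_of_real (pi * y)) = of_real (cosh (pi * y))"
    "sinh (complex_of_real (pi * y)) = of_real (sinh (pi * y))"
    unfolding cosh_field_def sinh_field_def exp_of_real of_real_minus[symmetric] by simp_all
  ultimately have
    "of_real (cosh (pi * y)) / of_real pi * (Digamma (1 - z) - Digamma z) = - \<i> * of_real (sinh (pi * y))"
    by (simp only:)
  then have "of_real (cosh (pi * y)) * (Digamma (1 - z) - Digamma z) = of_real pi * (- \<i> * of_real (sinh (pi * y)))"
    by (simp add: divide_eq_eq mult_ac)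
  moreover have "complex_of_real (cosh (pi * y)) \<noteq> 0" by simp
  ultimately have "Digamma (1 - z) - Digamma z = of_real pi * (- \<i> * of_real (sinh (pi * y))) / of_real (cosh (pi * y))"
    by (metis nonzero_mult_div_cancel_left)
  also have "\<i> * \<dots> = of_real (pi * tanh (pi * y))"
    by (simp add: complex_eq_iff tanh_def)
  finally have *: "\<i> * (Digamma (1 - z) - Digamma z) = of_real (pi * tanh (pi * y))" .
  \<comment> \<open>In the difference of the two Digamma series the Euler-Mascheroni constants and
    the terms \<open>inverse (of_nat (Suc k))\<close> cancel.\<close>
  have "(\<lambda>k. (inverse (of_nat (Suc k)) - inverse ((1 - z) + of_nat k))
       - (inverse (of_nat (Suc k)) - inverse (z + of_nat k))) sums (Digamma (1 - z) - Digamma z)"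
    using summable_sums[OF summable_diff[OF summable_Digamma[OF nz(2)] summable_Digamma[OF nz(1)]]]
      suminf_diff[OF summable_Digamma[OF nz(2)] summable_Digamma[OF nz(1)]]
    unfolding Digamma_def by simp
  moreover have "(inverse (of_nat (Suc k)) - inverse ((1 - z) + of_nat k))
       - (inverse (of_nat (Suc k)) - inverse (z + of_nat k)) =
       inverse (z + of_nat k) - inverse ((1 - z) + of_nat k)" for k by simp
  ultimately have "(\<lambda>k. inverse (z + of_nat k) - inverse ((1 - z) + of_nat k)) sums (Digamma (1 - z) - Digamma z)"
    by (simp only:)
  from sums_mult[OF this, of \<i>]
  have "(\<lambda>k. \<i> * (inverse (z + of_nat k) - inverse ((1 - z) + of_nat k))) sums of_real (pi * tanh (pi * y))"
    unfolding * .
  moreover have "\<i> * (inverse (z + of_nat k) - inverse ((1 - z) + of_nat k)) =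
      of_real (2 * y / ((real k + 1/2)\<^sup>2 + y\<^sup>2))" for k
  proof -
    define a where "a = real k + 1/2"
    \<comment> \<open>Since 1 - z is the conjugate of z, the difference of reciprocals is purely
      imaginary.\<close>
    have "z + of_nat k = Complex a y" "(1 - z) + of_nat k = Complex a (- y)"
      by (simp_all add: complex_eq_iff z_def a_def)
    then show ?thesis
      unfolding a_def[symmetric] by (simp add: complex_eq_iff)
  qed
  ultimately show ?thesis by (simp only: sums_of_real_iff)
qed

text \<open>Grouping the Basel series in pairs isolates the even squares, which contribute a quarter
  of the whole; subtracting them leaves 3/4 of pi^2/6.\<close>

lemma inverse_odd_squares_sums: "(\<lambda>k. 1 / (real (2 * k + 1))\<^sup>2) sums (pi\<^sup>2 / 8)"
proof -
  let ?a = "\<lambda>n. 1 / (real n + 1)\<^sup>2"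
  have "(\<lambda>m. sum ?a {m * 2..<m * 2 + 2}) sums (pi\<^sup>2 / 6)"
    using sums_group[OF inverse_squares_sums, of 2] by (simp add: add.commute)
  moreover have "sum ?a {m * 2..<m * 2 + 2} = ?a (2 * m) + ?a m / 4" for m
  proof -
    have "{m * 2..<m * 2 + 2} = {2 * m, 2 * m + 1}" by auto
    then show ?thesis by (simp add: power2_eq_square field_simps)
  qed
  ultimately have "(\<lambda>m. ?a (2 * m) + ?a m / 4) sums (pi\<^sup>2 / 6)" by simp
  from sums_diff[OF this sums_divide[OF inverse_squares_sums, of 4]]
  show ?thesis by (simp add: add.commute)
qed

text \<open>The value at 0 is the limit of tanh(x)/x; the quotient itself would evaluate to 0
  there.\<close>

definition tent_transform :: "real \<Rightarrow> real" where
  "tent_transform w = (if w = 0 then 1 else tanh (w / 2) / (w / 2))"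

text \<open>The k-th term is the Fourier transform of the k-th exponential in
  \<open>tent_sums\<close>. For w nonzero the sum is \<open>tanh_partial_fractions\<close> at w / (2
  pi), rescaled; that rescaling divides by w, so w = 0 is handled by the odd squares.\<close>

lemma tent_transform_sums:
  "(\<lambda>k. 8 / ((real (2 * k + 1) * pi)\<^sup>2 + w\<^sup>2)) sums tent_transform w"
proof (cases "w = 0")
  case True
  then show ?thesis
    using sums_mult[OF inverse_odd_squares_sums, of "8 / pi\<^sup>2"]
    by (simp add: tent_transform_def power_mult_distrib mult_ac)
next
  case False
  have "2 / (pi * w) * (2 * (w / (2 * pi)) / ((real k + 1/2)\<^sup>2 + (w / (2 * pi))\<^sup>2)) =
      8 / ((real (2 * k + 1) * pi)\<^sup>2 + w\<^sup>2)" for k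
  proof -
    have "(real k + 1/2)\<^sup>2 + (w / (2 * pi))\<^sup>2 = ((real (2 * k + 1) * pi)\<^sup>2 + w\<^sup>2) / (4 * pi\<^sup>2)"
      by (simp add: power2_eq_square field_simps)
    then show ?thesis using False by (simp add: power2_eq_square)
  qed
  moreover have "2 / (pi * w) * (pi * tanh (pi * (w / (2 * pi)))) = tent_transform w"
    using False by (simp add: tent_transform_def)
  ultimately show ?thesis
    using sums_mult[OF tanh_partial_fractions[of "w / (2 * pi)"], of "2 / (pi * w)"] by simp
qed

lemma tent_transform_minus [simp]: "tent_transform (- w) = tent_transform w"
  by (simp add: tent_transform_def)

text \<open>Taking exp(-(a + b)/2) out of the difference and the sum of the exponentials leaves
  tanh((a - b)/2) as their ratio. This identity connects the derivative of the exponential with the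
  channel.\<close>

lemma tent_transform_mult_exp_sum:
  "(exp (- a) + exp (- b)) / 2 * tent_transform (a - b) =
    (if a = b then exp (- a) else (exp (- b) - exp (- a)) / (a - b))"
proof (cases "a = b")
  case False
  have "tanh ((a - b) / 2) = (exp (- b) - exp (- a)) / (exp (- b) + exp (- a))"
  proof -
    have "exp (- b) - exp (- a) = exp (- (a + b) / 2) * (exp ((a - b) / 2) - exp (- ((a - b) / 2)))"
      "exp (- b) + exp (- a) = exp (- (a + b) / 2) * (exp ((a - b) / 2) + exp (- ((a - b) / 2)))"
      by (simp_all add: algebra_simps diff_divide_distrib add_divide_distrib flip: exp_add)
    then show ?thesis
      by (simp only: tanh_altdef) simp
  qed
  moreover have "exp (- b) + exp (- a) > 0" by (simp add: add_pos_pos)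
  ultimately show ?thesis
    using False by (simp add: tent_transform_def divide_simps) (simp add: algebra_simps)
qed (simp add: tent_transform_def)

lemma borel_measurable_tent: "tent \<in> borel_measurable borel"
proof -
  have [measurable]: "(\<lambda>t. cosh (pi * t / 2)) \<in> borel_measurable borel" "(\<lambda>t. sinh (pi * t / 2)) \<in> borel_measurable borel"
    by (intro borel_measurable_continuous_onI continuous_intros; simp)+
  show ?thesis
    unfolding tent_def [abs_def] coth_def by measurable
qed

text \<open>Termwise integration of \<open>tent_sums\<close>. The exchange of sum and integral is
  allowed because the integrals of the norms form the convergent series of
  \<open>tent_transform_sums\<close> at w = 0.\<close>

lemma has_bochner_integral_tent:
  "has_bochner_integral lborel (\<lambda>t. of_real (tent t) * exp (- \<i> * of_real (w * t)))
    (complex_of_real (tent_transform w))"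
proof -
  define c where "c k = real (2 * k + 1) * pi" for k
  define f where "f k t = of_real (4 / (c k)) * (of_real (exp (- c k * \<bar>t\<bar>)) * exp (- \<i> * complex_of_real (w * t)))"
    for k t
  have c: "c k > 0" for k by (simp add: c_def)
  have f_int: "has_bochner_integral lborel (f k) (of_real (8 / ((c k)\<^sup>2 + w\<^sup>2)))" for k
  proof -
    have "of_real (4 / c k) * complex_of_real (2 * c k / ((c k)\<^sup>2 + w\<^sup>2)) = of_real (8 / ((c k)\<^sup>2 + w\<^sup>2))"
      unfolding of_real_mult[symmetric] using c[of k] by simp
    then show ?thesis
      using has_bochner_integral_mult_right[OF has_bochner_integral_exp_abs[OF c, of k w], of "of_real (4 / c k)"]
      unfolding f_def by metis
  qed
  have tent_c: "(\<lambda>k. 4 / c k * exp (- c k * \<bar>t\<bar>)) sums tent t" if "t \<noteq> 0" for t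
    using tent_sums[OF that] by (simp add: c_def mult_ac)
  have norm_f: "norm (f k t) = 4 / c k * exp (- c k * \<bar>t\<bar>)" for k t
    using c[of k] by (simp add: f_def norm_mult norm_divide)
  have "has_bochner_integral lborel (\<lambda>t. norm (f k t)) (8 / (c k)\<^sup>2)" for k
  proof -
    \<comment> \<open>At frequency 0 the oscillating factor is 1, so the transform already computed
      gives the integral of the norm.\<close>
    have "has_bochner_integral lborel (\<lambda>t. Re (of_real (exp (- c k * \<bar>t\<bar>)) * exp (- \<i> * of_real (0 * t))))
      (Re (complex_of_real (2 * c k / ((c k)\<^sup>2 + 0\<^sup>2))))"
      by (intro has_bochner_integral_Re has_bochner_integral_exp_abs c)
    from has_bochner_integral_mult_right[OF this, of "4 / c k"] show ?thesis
      using c[of k] by (simp add: norm_f power2_eq_square field_simps)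
  qed
  then have norm_int: "(\<integral>t. norm (f k t) \<partial>lborel) = 8 / (c k)\<^sup>2" for k
    by (simp add: has_bochner_integral_integral_eq)
  have norm_summable: "summable (\<lambda>k. \<integral>t. norm (f k t) \<partial>lborel)"
    using tent_transform_sums[of 0] unfolding norm_int c_def by (simp add: sums_iff)
  have AE_summable: "AE t in lborel. summable (\<lambda>k. norm (f k t))"
    using AE_lborel_singleton[of "0::real"]
    by eventually_elim (auto simp: norm_f sums_iff dest!: tent_c)
  note prems = has_bochner_integral_iff[THEN iffD1, OF f_int, THEN conjunct1] AE_summable norm_summable
  have AE_eq: "AE t in lborel. (\<Sum>k. f k t) = of_real (tent t) * exp (- \<i> * of_real (w * t))"
    using AE_lborel_singleton[of "0::real"]
  proof eventually_elim
    case (elim t)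
    then have "(\<lambda>k. of_real (4 / c k * exp (- c k * \<bar>t\<bar>)) * exp (- \<i> * of_real (w * t)))
        sums (of_real (tent t) * exp (- \<i> * complex_of_real (w * t)))"
      by (intro sums_mult2 sums_of_real tent_c) simp
    then show ?case by (simp add: f_def sums_iff mult_ac)
  qed
  have "has_bochner_integral lborel (\<lambda>t. \<Sum>k. f k t) (\<Sum>k. integral\<^sup>L lborel (f k))"
    unfolding has_bochner_integral_iff
    using integrable_suminf[OF prems] integral_suminf[OF prems] by simp
  moreover have "(\<Sum>k. integral\<^sup>L lborel (f k)) = of_real (tent_transform w)"
  proof (rule sums_unique[symmetric])
    have "integral\<^sup>L lborel (f k) = of_real (8 / ((c k)\<^sup>2 + w\<^sup>2))" for k
      by (rule has_bochner_integral_integral_eq[OF f_int])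
    then show "(\<lambda>k. integral\<^sup>L lborel (f k)) sums complex_of_real (tent_transform w)"
      using sums_of_real[OF tent_transform_sums[of w]] unfolding c_def by (simp only:)
  qed
  ultimately have "has_bochner_integral lborel (\<lambda>t. \<Sum>k. f k t) (of_real (tent_transform w))" by simp
  \<comment> \<open>Replacing the series by its almost-everywhere value requires both functions to
    be measurable.\<close>
  moreover have "(\<lambda>t. \<Sum>k. f k t) \<in> borel_measurable lborel"
    using calculation unfolding has_bochner_integral_iff by (rule borel_measurable_integrable[OF conjunct1])
  moreover have "(\<lambda>t. of_real (tent t) * exp (- \<i> * complex_of_real (w * t))) \<in> borel_measurable lborel"
  proof -
    have "(\<lambda>t. exp (- \<i> * complex_of_real (w * t))) \<in> borel_measurable lborel"
      unfolding measurable_lborel2 by (intro borel_measurable_continuous_onI continuous_intros)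
    then show ?thesis using borel_measurable_tent by simp
  qed
  ultimately show ?thesis
    using AE_eq by (subst (asm) has_bochner_integral_cong_AE) auto
qed

subsection \<open>Complex matrices\<close>

lemma cscale_nth [simp]: "cscale c A $ a $ b = c * A $ a $ b"
  by (simp add: cscale_def)

lemma cadj_nth [simp]: "cadj A $ a $ b = cnj (A $ b $ a)"
  by (simp add: cadj_def)

lemma matrix_mult_nth: "(A ** B) $ a $ b = (\<Sum>c\<in>UNIV. A $ a $ c * B $ c $ b)"
  by (simp add: matrix_matrix_mult_def)

lemma mat_nth: "mat x $ a $ b = (if a = b then x else 0)"
  by (simp add: mat_def)

definition diagm :: "('n \<Rightarrow> complex) \<Rightarrow> 'n::finite cmat" where
  "diagm d = (\<chi> a b. if a = b then d a else 0)"

lemma diagm_nth [simp]: "diagm d $ a $ b = (if a = b then d a else 0)"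
  by (simp add: diagm_def)

lemma diagm_mult_nth [simp]: "(diagm d ** A) $ a $ b = d a * A $ a $ b"
  by (simp add: matrix_mult_nth if_distrib[of "\<lambda>x. x * _"] cong: if_cong)

lemma mult_diagm_nth [simp]: "(A ** diagm d) $ a $ b = A $ a $ b * d b"
  by (simp add: matrix_mult_nth if_distrib[of "\<lambda>x. _ * x"] cong: if_cong)

lemma cscale_mult_left: "cscale c A ** B = cscale c (A ** B)"
  by (simp add: vec_eq_iff matrix_mult_nth sum_distrib_left mult.assoc)

lemma cscale_mult_right: "A ** cscale c B = cscale c (A ** B)"
  by (simp add: vec_eq_iff matrix_mult_nth sum_distrib_left mult_ac)

lemma cscale_cscale: "cscale c (cscale d A) = cscale (c * d) A"
  by (simp add: vec_eq_iff mult.assoc)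

lemma cadj_mult: "cadj (A ** B) = cadj B ** cadj A"
  by (simp add: vec_eq_iff matrix_mult_nth mult.commute)

lemma cadj_cadj [simp]: "cadj (cadj A) = A"
  by (simp add: vec_eq_iff)

lemma cadj_mat_1 [simp]: "cadj (mat 1) = mat 1"
  by (simp add: vec_eq_iff mat_nth eq_commute)

lemma hermitian_cscale: "hermitian A \<Longrightarrow> c \<in> \<real> \<Longrightarrow> hermitian (cscale c A)"
  by (auto simp: hermitian_def vec_eq_iff elim!: Reals_cases)

lemma linear_nth2: "linear (\<lambda>A::'n::finite cmat. A $ a $ b)"
  by (rule linearI) simp_all

lemma linear_cadj: "linear (cadj :: 'n::finite cmat \<Rightarrow> _)"
  by (rule linearI) (simp_all add: vec_eq_iff)

text \<open>Through \<open>linear_sums\<close>, this carries power series across a change of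
  basis.\<close>

lemma linear_conj: "linear (\<lambda>X::'n::finite cmat. (P::'n cmat) ** X ** (Q::'n cmat))"
proof (rule linearI)
  show "P ** (X + Y) ** Q = P ** X ** Q + P ** Y ** Q" for X Y
    by (simp add: matrix_add_ldistrib) (simp add: vec_eq_iff matrix_mult_nth distrib_right sum.distrib)
  have scaleR: "r *\<^sub>R X = cscale (of_real r) X" for r and X :: "'n cmat"
    by (simp add: vec_eq_iff scaleR_conv_of_real[where 'a = complex])
  show "P ** (r *\<^sub>R X) ** Q = r *\<^sub>R (P ** X ** Q)" for r X
    unfolding scaleR by (simp add: cscale_mult_left cscale_mult_right)
qed

lemma linear_sums:
  fixes f :: "'a::euclidean_space \<Rightarrow> 'b::real_normed_vector"
  assumes "linear f" "X sums x"
  shows "(\<lambda>n. f (X n)) sums f x"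
  using bounded_linear.sums assms by (auto simp: linear_conv_bounded_linear)

subsection \<open>The matrix exponential\<close>

text \<open>Each entry of a product is a sum of \<open>CARD('n)\<close> terms, so every factor costs
  \<open>CARD('n) * K\<close>. Convergence is treated entry by entry throughout.\<close>

lemma mpow_nth_bound:
  fixes A :: "'n::finite cmat"
  assumes "\<And>a b. norm (A $ a $ b) \<le> K"
  shows "norm (mpow A n $ a $ b) \<le> (real CARD('n) * K) ^ n"
proof (induction n arbitrary: a b)
  case 0
  then show ?case by (simp add: mat_nth)
next
  case (Suc n)
  have K: "0 \<le> K" by (rule order_trans[OF norm_ge_zero assms(1)])
  have "norm (mpow A (Suc n) $ a $ b) \<le> (\<Sum>c\<in>UNIV. norm (A $ a $ c * mpow A n $ c $ b))"
    by (simp add: matrix_mult_nth norm_sum)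
  also have "\<dots> \<le> (\<Sum>c\<in>(UNIV::'n set). K * (real CARD('n) * K) ^ n)"
    unfolding norm_mult by (intro sum_mono mult_mono assms Suc.IH) (use K in auto)
  finally show ?case by simp
qed

lemma norm_nth2_le: "norm (A $ a $ b) \<le> norm (A::'n::finite cmat)"
  by (rule order_trans[OF Finite_Cartesian_Product.norm_nth_le Finite_Cartesian_Product.norm_nth_le])

lemma summable_mexp_nth:
  fixes A :: "'n::finite cmat"
  shows "summable (\<lambda>n. norm (mpow A n $ a $ b / fact n))"
proof (rule summable_comparison_test')
  show "summable (\<lambda>n. inverse (fact n) * (real CARD('n) * norm A) ^ n)" by (rule summable_exp)
  show "norm (norm (mpow A n $ a $ b / fact n)) \<le> inverse (fact n) * (real CARD('n) * norm A) ^ n" for n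
    using divide_right_mono[OF mpow_nth_bound[OF norm_nth2_le[of A], of n a b], of "fact n"]
    by (simp add: norm_divide inverse_eq_divide)
qed

lemma sums_cmatI:
  fixes X :: "nat \<Rightarrow> 'n::finite cmat"
  assumes "\<And>a b. (\<lambda>n. X n $ a $ b) sums (L $ a $ b)"
  shows "X sums L"
  unfolding sums_def by (intro vec_tendstoI) (use assms in \<open>simp add: sums_def\<close>)

lemma mexp_sums: "(\<lambda>n. (1 / fact n) *\<^sub>R mpow A n) sums mexp A"
proof -
  have "(\<lambda>n. (1 / fact n) *\<^sub>R mpow A n) sums (\<chi> a b. \<Sum>n. mpow A n $ a $ b / fact n)"
    by (rule sums_cmatI)
      (use summable_sums[OF summable_norm_cancel[OF summable_mexp_nth[of A]]] in
        \<open>simp add: scaleR_conv_of_real[where 'a = complex]\<close>)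
  then show ?thesis unfolding mexp_def by (simp add: sums_iff)
qed

lemma mexp_nth_sums: "(\<lambda>n. mpow A n $ a $ b / fact n) sums (mexp A $ a $ b)"
  using linear_sums[OF linear_nth2 mexp_sums[of A], of a b] by (simp add: scaleR_conv_of_real[where 'a = complex])

lemma mexp_eqI:
  fixes A :: "'n::finite cmat"
  assumes "\<And>a b. (\<lambda>n. mpow A n $ a $ b / fact n) sums (L $ a $ b)"
  shows "mexp A = L"
  using sums_unique2[OF mexp_nth_sums assms] by (simp add: vec_eq_iff)

lemma mpow_add: "mpow A (m + n) = mpow A m ** mpow A n"
  by (induction m) (simp_all add: matrix_mul_assoc)

lemma mpow_Suc2: "mpow A (Suc n) = mpow A n ** A"
  using mpow_add[of A n 1] by simp

lemma mpow_cscale: "mpow (cscale c A) n = cscale (c ^ n) (mpow A n)"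
proof (induction n)
  case (Suc n)
  then show ?case by (simp add: cscale_mult_left cscale_mult_right cscale_cscale mult.commute)
qed (simp add: cscale_def vec_eq_iff)

lemma mpow_conj:
  fixes P Q A :: "'n::finite cmat"
  assumes "P ** Q = mat 1" "Q ** P = mat 1"
  shows "mpow (P ** A ** Q) n = P ** mpow A n ** Q"
proof (induction n)
  case (Suc n)
  have "P ** A ** Q ** (P ** mpow A n ** Q) = P ** A ** (Q ** P) ** mpow A n ** Q"
    by (simp only: matrix_mul_assoc)
  then show ?case using Suc by (simp add: assms matrix_mul_assoc)
qed (simp add: assms)

lemma mexp_conj:
  fixes P Q A :: "'n::finite cmat"
  assumes "P ** Q = mat 1" "Q ** P = mat 1"
  shows "mexp (P ** A ** Q) = P ** mexp A ** Q"
proof -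
  have "(\<lambda>n. P ** ((1 / fact n) *\<^sub>R mpow A n) ** Q) sums (P ** mexp A ** Q)"
    by (rule linear_sums[OF linear_conj mexp_sums])
  moreover have "P ** ((1 / fact n) *\<^sub>R mpow A n) ** Q = (1 / fact n) *\<^sub>R mpow (P ** A ** Q) n" for n
    unfolding mpow_conj[OF assms] by (rule linear_cmul[OF linear_conj])
  ultimately show ?thesis using sums_unique2[OF mexp_sums] by simp
qed

lemma mpow_diagm: "mpow (diagm d) n = diagm (\<lambda>a. d a ^ n)"
  by (induction n) (simp_all add: vec_eq_iff mat_nth)

lemma mexp_diagm: "mexp (diagm d) = diagm (\<lambda>a. exp (d a))"
proof (rule mexp_eqI)
  show "(\<lambda>n. mpow (diagm d) n $ a $ b / fact n) sums (diagm (\<lambda>a. exp (d a)) $ a $ b)" for a b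
    using exp_converges[of "d a"] by (auto simp: mpow_diagm scaleR_conv_of_real[where 'a = complex] divide_inverse mult.commute)
qed

text \<open>Multiples of one matrix commute, so the Cauchy product of the entrywise series is summed
  by the binomial theorem.\<close>

lemma mexp_cscale_mult: "mexp (cscale s A) ** mexp (cscale t A) = mexp (cscale (s + t) A)"
proof (rule mexp_eqI[symmetric])
  fix a b
  let ?f = "\<lambda>s n a b. mpow (cscale s A) n $ a $ b / fact n"
  have "(\<lambda>n. \<Sum>c\<in>UNIV. \<Sum>i\<le>n. ?f s i a c * ?f t (n - i) c b) sums
     (\<Sum>c\<in>UNIV. (\<Sum>n. ?f s n a c) * (\<Sum>n. ?f t n c b))"
    by (intro sums_sum Cauchy_product_sums summable_mexp_nth)
  also have "(\<lambda>n. \<Sum>c\<in>UNIV. \<Sum>i\<le>n. ?f s i a c * ?f t (n - i) c b) = (\<lambda>n. ?f (s + t) n a b)"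
  proof
    fix n
    have "(\<Sum>c\<in>UNIV. \<Sum>i\<le>n. ?f s i a c * ?f t (n - i) c b) =
        (\<Sum>i\<le>n. s ^ i * t ^ (n - i) / (fact i * fact (n - i)) * (mpow A i ** mpow A (n - i)) $ a $ b)"
      unfolding matrix_mult_nth
      by (subst sum.swap) (simp add: sum_distrib_left mpow_cscale mult_ac)
    also have "\<dots> = (\<Sum>i\<le>n. of_nat (n choose i) * s ^ i * t ^ (n - i)) / fact n * mpow A n $ a $ b"
      by (simp add: sum_distrib_right sum_divide_distrib binomial_fact flip: mpow_add)
    also have "\<dots> = ?f (s + t) n a b"
      by (simp add: mpow_cscale binomial_ring)
    finally show "(\<Sum>c\<in>UNIV. \<Sum>i\<le>n. ?f s i a c * ?f t (n - i) c b) = ?f (s + t) n a b" .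
  qed
  also have "(\<Sum>c\<in>UNIV. (\<Sum>n. ?f s n a c) * (\<Sum>n. ?f t n c b)) = (mexp (cscale s A) ** mexp (cscale t A)) $ a $ b"
    by (simp add: matrix_mult_nth sums_unique[OF mexp_nth_sums])
  finally show "(\<lambda>n. ?f (s + t) n a b) sums ((mexp (cscale s A) ** mexp (cscale t A)) $ a $ b)" .
qed

lemma mexp_0 [simp]: "mexp (cscale 0 A) = mat 1"
  using mexp_diagm[of "\<lambda>_. 0"] by (simp add: cscale_def diagm_def mat_def cong: if_cong)

lemma mexp_half: "mexp A = mexp (cscale (1/2) A) ** mexp (cscale (1/2) A)"
  unfolding mexp_cscale_mult by (simp add: cscale_def)

lemma hermitian_mexp:
  assumes "hermitian A"
  shows "hermitian (mexp A)"
proof -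
  have adj: "cadj (mpow A n) = mpow A n" for n
  proof (induction n)
    case (Suc n)
    have "cadj (mpow A (Suc n)) = cadj (mpow A n) ** cadj A" by (simp add: cadj_mult)
    also have "\<dots> = mpow A n ** A" using Suc assms by (simp add: hermitian_def)
    finally show ?case by (simp only: mpow_Suc2)
  qed simp
  have "(\<lambda>n. cadj ((1 / fact n) *\<^sub>R mpow A n)) sums cadj (mexp A)"
    by (rule linear_sums[OF linear_cadj mexp_sums])
  moreover have "cadj ((1 / fact n) *\<^sub>R mpow A n) = (1 / fact n) *\<^sub>R mpow A n" for n
    unfolding linear_cmul[OF linear_cadj] adj ..
  ultimately show ?thesis
    unfolding hermitian_def using sums_unique2[OF mexp_sums, of A "cadj (mexp A)"] by simp
qed

lemma hermitian_nth: "hermitian A \<Longrightarrow> cnj (A $ a $ b) = A $ b $ a"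
  unfolding hermitian_def by (metis cadj_nth)

text \<open>Moving one factor \<open>Q\<close> to the left argument leaves the squared norm of
  \<open>Q *v w\<close>. With \<open>mexp_half\<close> this makes exponentials of Hermitian matrices
  positive.\<close>

lemma hermitian_square_quadratic_form:
  assumes "hermitian Q"
  shows "(\<Sum>a\<in>UNIV. cnj (w $ a) * ((Q ** Q) *v w) $ a) = of_real (\<Sum>c\<in>UNIV. (norm ((Q *v w) $ c))\<^sup>2)"
proof -
  have "(\<Sum>a\<in>UNIV. cnj (w $ a) * ((Q ** Q) *v w) $ a) =
      (\<Sum>a\<in>UNIV. \<Sum>c\<in>UNIV. cnj (w $ a) * (Q $ a $ c * (Q *v w) $ c))"
    by (simp add: matrix_vector_mul_assoc[symmetric] matrix_vector_mult_def[of Q] sum_distrib_left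
      del: matrix_vector_mul_assoc)
  also have "\<dots> = (\<Sum>c\<in>UNIV. (\<Sum>a\<in>UNIV. cnj (w $ a) * Q $ a $ c) * (Q *v w) $ c)"
    by (subst sum.swap) (simp add: sum_distrib_right mult.assoc)
  also have "\<dots> = (\<Sum>c\<in>UNIV. cnj ((Q *v w) $ c) * (Q *v w) $ c)"
    using hermitian_nth[OF assms] by (simp add: matrix_vector_mult_def mult.commute)
  also have "\<dots> = of_real (\<Sum>c\<in>UNIV. (norm ((Q *v w) $ c))\<^sup>2)"
    unfolding of_real_sum complex_norm_square by (simp only: mult.commute)
  finally show ?thesis .
qed

text \<open>The entry is the squared norm of row \<open>a\<close> of the Hermitian root
  \<open>Q\<close> = exp(A/2), and an invertible matrix has no zero row. This yields both a positive
  partition function and positive eigenvalues.\<close>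

lemma mexp_diagonal_pos:
  assumes "hermitian A"
  obtains r where "r > 0" "mexp A $ a $ a = of_real r"
proof -
  define Q where "Q = mexp (cscale (1/2) A)"
  have Q: "hermitian Q" unfolding Q_def by (intro hermitian_mexp hermitian_cscale assms) simp
  have "Q ** mexp (cscale (- 1/2) A) = mat 1"
    unfolding Q_def mexp_cscale_mult by simp
  then have "(\<Sum>c\<in>UNIV. Q $ a $ c * mexp (cscale (- 1/2) A) $ c $ a) = 1"
    unfolding matrix_mult_nth[symmetric] by (simp add: mat_nth)
  then have "\<exists>c. Q $ a $ c \<noteq> 0"
    by (rule contrapos_pp) simp
  then obtain c where c: "Q $ a $ c \<noteq> 0" ..
  have "mexp A $ a $ a = (\<Sum>c\<in>UNIV. Q $ a $ c * cnj (Q $ a $ c))"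
    unfolding mexp_half[of A] hermitian_nth[OF Q] Q_def[symmetric] by (rule matrix_mult_nth)
  also have "\<dots> = of_real (\<Sum>c\<in>UNIV. (norm (Q $ a $ c))\<^sup>2)"
    unfolding of_real_sum complex_norm_square ..
  finally show thesis
    by (intro that[of "\<Sum>c\<in>UNIV. (norm (Q $ a $ c))\<^sup>2"] sum_pos2[of _ c]) (use c in auto)
qed

subsection \<open>Derivative of the matrix exponential\<close>

text \<open>The derivative of \<open>(A + s B)\<^sup>n\<close> at \<open>s = 0\<close>.\<close>

primrec dmpow :: "'n::finite cmat \<Rightarrow> 'n cmat \<Rightarrow> nat \<Rightarrow> 'n cmat" where
  "dmpow A B 0 = 0"
| "dmpow A B (Suc n) = B ** mpow A n + A ** dmpow A B n"

text \<open>Stated at every \<open>s\<close>, not only at 0, since differentiating the series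
  termwise needs derivatives on a whole disc.\<close>

lemma has_field_derivative_mpow_nth:
  "((\<lambda>s. mpow (A + cscale s B) n $ a $ b) has_field_derivative dmpow (A + cscale s B) B n $ a $ b) (at s within S)"
proof (induction n arbitrary: a b)
  case (Suc n)
  have "((\<lambda>s. \<Sum>c\<in>UNIV. (A $ a $ c + s * B $ a $ c) * mpow (A + cscale s B) n $ c $ b) has_field_derivative
     (\<Sum>c\<in>UNIV. B $ a $ c * mpow (A + cscale s B) n $ c $ b +
        dmpow (A + cscale s B) B n $ c $ b * (A $ a $ c + s * B $ a $ c))) (at s within S)"
    by (intro DERIV_sum DERIV_mult Suc.IH) (auto intro!: derivative_eq_intros)
  then show ?case
    by (simp add: matrix_mult_nth sum.distrib mult.commute)
qed simp

text \<open>\<open>dmpow A B n\<close> is a sum of n words of length n, each with a single letter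
  \<open>B\<close>.\<close>

lemma dmpow_nth_bound:
  fixes A B :: "'n::finite cmat"
  assumes "\<And>a b. norm (A $ a $ b) \<le> K" "\<And>a b. norm (B $ a $ b) \<le> K"
  shows "norm (dmpow A B n $ a $ b) \<le> real n * (real CARD('n) * K) ^ n"
proof (induction n arbitrary: a b)
  case (Suc n)
  let ?M = "real CARD('n) * K"
  have K: "0 \<le> K" by (rule order_trans[OF norm_ge_zero assms(1)])
  have "norm (dmpow A B (Suc n) $ a $ b) \<le>
      norm (\<Sum>c\<in>UNIV. B $ a $ c * mpow A n $ c $ b) + norm (\<Sum>c\<in>UNIV. A $ a $ c * dmpow A B n $ c $ b)"
    by (simp add: matrix_mult_nth norm_triangle_ineq)
  also have "\<dots> \<le> (\<Sum>c\<in>(UNIV::'n set). K * ?M ^ n) + (\<Sum>c\<in>(UNIV::'n set). K * (real n * ?M ^ n))"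
    by (intro add_mono order_trans[OF norm_sum] sum_mono, unfold norm_mult,
        intro mult_mono assms mpow_nth_bound, use K in simp_all,
        intro mult_mono assms Suc.IH, use K in simp_all)
  also have "\<dots> = real (Suc n) * ?M ^ Suc n" by (simp add: algebra_simps)
  finally show ?case .
qed simp

lemma summable_exp_deriv: "summable (\<lambda>n. real n * M ^ n / fact n)"
proof -
  have "(\<lambda>n. M * (inverse (fact n) * M ^ n)) = (\<lambda>n. real (Suc n) * M ^ Suc n / fact (Suc n))"
    by (auto simp: fun_eq_iff divide_simps simp del: of_nat_Suc)
  then have "summable (\<lambda>n. real (Suc n) * M ^ Suc n / fact (Suc n))"
    using summable_mult[OF summable_exp] by metis
  then show ?thesis by (subst (asm) summable_Suc_iff)
qed

text \<open>The bound is uniform over the unit disc, as the Weierstrass test demands.\<close>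

lemma norm_dmpow_nth_le:
  fixes A B :: "'n::finite cmat"
  assumes "norm s \<le> 1"
  shows "norm (dmpow (A + cscale s B) B n $ a $ b / fact n) \<le>
    real n * (real CARD('n) * (norm A + norm B)) ^ n / fact n"
proof -
  have "norm ((A + cscale s B) $ a $ b) \<le> norm A + norm B" for a b
  proof -
    have "norm ((A + cscale s B) $ a $ b) \<le> norm (A $ a $ b) + norm s * norm (B $ a $ b)"
      by (simp add: norm_triangle_ineq flip: norm_mult)
    also have "\<dots> \<le> norm A + 1 * norm B"
      by (intro add_mono mult_mono norm_nth2_le assms) auto
    finally show ?thesis by simp
  qed
  moreover have "norm (B $ a $ b) \<le> norm A + norm B" for a b
    using norm_nth2_le[of B a b] norm_ge_zero[of A] by linarith
  ultimately have "norm (dmpow (A + cscale s B) B n $ a $ b) \<le> real n * (real CARD('n) * (norm A + norm B)) ^ n"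
    by (rule dmpow_nth_bound)
  then show ?thesis by (simp add: norm_divide divide_right_mono)
qed

text \<open>The directional derivative of the matrix exponential at \<open>A\<close> along
  \<open>B\<close>, as a series.\<close>

definition dmexp :: "'n::finite cmat \<Rightarrow> 'n cmat \<Rightarrow> 'n cmat" where
  "dmexp A B = (\<chi> a b. \<Sum>n. dmpow A B n $ a $ b / fact n)"

lemma dmexp_nth_sums: "(\<lambda>n. dmpow A B n $ a $ b / fact n) sums (dmexp A B $ a $ b)"
proof -
  have "summable (\<lambda>n. dmpow A B n $ a $ b / fact n)"
    by (rule summable_comparison_test'[OF summable_exp_deriv])
      (use norm_dmpow_nth_le[of 0 A B] in \<open>simp add: cscale_def zero_vec_def[symmetric]\<close>)
  then show ?thesis by (simp add: dmexp_def summable_sums)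
qed

lemma dmexp_sums: "(\<lambda>n. (1 / fact n) *\<^sub>R dmpow A B n) sums dmexp A B"
  by (rule sums_cmatI) (use dmexp_nth_sums in \<open>simp add: scaleR_conv_of_real[where 'a = complex]\<close>)

text \<open>Termwise differentiation on the unit disc, where the differentiated series converges
  uniformly by the M-test.\<close>

lemma has_field_derivative_mexp_nth:
  fixes A B :: "'n::finite cmat"
  shows "((\<lambda>s. mexp (A + cscale s B) $ a $ b) has_field_derivative dmexp A B $ a $ b) (at 0)"
proof -
  let ?f = "\<lambda>n s. mpow (A + cscale s B) n $ a $ b / fact n"
  let ?f' = "\<lambda>n s. dmpow (A + cscale s B) B n $ a $ b / fact n"
  have "((\<lambda>s. \<Sum>n. ?f n s) has_field_derivative (\<Sum>n. ?f' n 0)) (at 0)"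
  proof (rule has_field_derivative_series'(2))
    show "convex (ball 0 1 :: complex set)" by simp
    show "(?f n has_field_derivative ?f' n s) (at s within ball 0 1)" for n s
      by (intro DERIV_cdivide has_field_derivative_mpow_nth)
    show "uniformly_convergent_on (ball 0 1) (\<lambda>n s. \<Sum>i<n. ?f' i s)"
      by (rule Weierstrass_m_test'[OF _ summable_exp_deriv[of "real CARD('n) * (norm A + norm B)"]])
         (rule norm_dmpow_nth_le, simp)
    show "summable (\<lambda>n. ?f n 0)" by (rule summable_norm_cancel[OF summable_mexp_nth])
  qed simp_all
  then show ?thesis
    by (simp add: sums_unique[OF mexp_nth_sums, symmetric] dmexp_def cscale_def zero_vec_def[symmetric])
qed

text \<open>For a diagonal base point the words add up to the divided difference of x^n at the two
  diagonal entries. For n = 0 the truncated exponent \<open>n - 1\<close> is harmless because of the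
  factor n.\<close>

lemma dmpow_diagm_nth:
  "dmpow (diagm d) B n $ a $ b =
    (if d a = d b then of_nat n * d a ^ (n - 1) else (d a ^ n - d b ^ n) / (d a - d b)) * B $ a $ b"
proof (induction n)
  case (Suc n)
  have "dmpow (diagm d) B (Suc n) $ a $ b = B $ a $ b * d b ^ n + d a * dmpow (diagm d) B n $ a $ b"
    by (simp add: mpow_diagm)
  then show ?case
    unfolding Suc by (cases n) (auto simp: field_simps)
qed simp

lemma dmexp_diagm_nth:
  "dmexp (diagm d) B $ a $ b =
    (if d a = d b then exp (d a) else (exp (d a) - exp (d b)) / (d a - d b)) * B $ a $ b"
proof (rule sums_unique2[OF dmexp_nth_sums])
  have exp_sums: "(\<lambda>n. x ^ n / fact n) sums exp x" for x :: complex
    using exp_converges[of x] by (simp add: scaleR_conv_of_real[where 'a = complex] divide_inverse mult.commute)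
  show "(\<lambda>n. dmpow (diagm d) B n $ a $ b / fact n) sums
    ((if d a = d b then exp (d a) else (exp (d a) - exp (d b)) / (d a - d b)) * B $ a $ b)"
  proof (cases "d a = d b")
    case True
    \<comment> \<open>The term n = 0 vanishes, so shifting the index recovers the exponential
      series.\<close>
    have "(\<lambda>n. of_nat (Suc n) * d a ^ (Suc n - 1) / fact (Suc n)) sums exp (d a)"
      using exp_sums[of "d a"] by (simp add: divide_simps del: of_nat_Suc)
    then have "(\<lambda>n. of_nat n * d a ^ (n - 1) / fact n) sums exp (d a)"
      by (subst (asm) sums_Suc_iff) simp
    from sums_mult2[OF this, of "B $ a $ b"] show ?thesis
      using True by (simp add: dmpow_diagm_nth)
  next
    case False
    have "(d a ^ n / fact n - d b ^ n / fact n) / (d a - d b) * B $ a $ b = dmpow (diagm d) B n $ a $ b / fact n" for n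
      unfolding dmpow_diagm_nth using False by (simp add: divide_simps)
    with False show ?thesis
      using sums_mult2[OF sums_divide[OF sums_diff[OF exp_sums[of "d a"] exp_sums[of "d b"]], of "d a - d b"], of "B $ a $ b"]
      by (simp only: if_False)
  qed
qed

lemma dmpow_conj:
  fixes P Q A B :: "'n::finite cmat"
  assumes "P ** Q = mat 1" "Q ** P = mat 1"
  shows "dmpow (P ** A ** Q) (P ** B ** Q) n = P ** dmpow A B n ** Q"
proof (induction n)
  case (Suc n)
  have "P ** B ** Q ** (P ** mpow A n ** Q) = P ** (B ** (Q ** P) ** mpow A n) ** Q"
    "P ** A ** Q ** (P ** dmpow A B n ** Q) = P ** (A ** (Q ** P) ** dmpow A B n) ** Q"
    by (simp_all only: matrix_mul_assoc)
  then show ?case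
    unfolding dmpow.simps linear_add[OF linear_conj] Suc mpow_conj[OF assms] by (simp add: assms(2))
qed (simp add: linear_0[OF linear_conj])

lemma dmexp_conj:
  fixes P Q A B :: "'n::finite cmat"
  assumes "P ** Q = mat 1" "Q ** P = mat 1"
  shows "dmexp (P ** A ** Q) (P ** B ** Q) = P ** dmexp A B ** Q"
proof -
  have "(\<lambda>n. P ** ((1 / fact n) *\<^sub>R dmpow A B n) ** Q) sums (P ** dmexp A B ** Q)"
    by (rule linear_sums[OF linear_conj dmexp_sums])
  moreover have "P ** ((1 / fact n) *\<^sub>R dmpow A B n) ** Q = (1 / fact n) *\<^sub>R dmpow (P ** A ** Q) (P ** B ** Q) n" for n
    unfolding dmpow_conj[OF assms] by (rule linear_cmul[OF linear_conj])
  ultimately show ?thesis using sums_unique2[OF dmexp_sums] by simp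
qed

text \<open>The zero matrix is diagonal with all entries equal, so every divided difference is
  exp(0) = 1.\<close>

lemma has_field_derivative_mexp_cscale_nth:
  fixes B :: "'n::finite cmat"
  shows "((\<lambda>s. mexp (cscale s B) $ a $ b) has_field_derivative B $ a $ b) (at 0)"
proof -
  have "dmexp (diagm (\<lambda>_. 0)) B $ a $ b = B $ a $ b"
    by (simp add: dmexp_diagm_nth)
  moreover have "diagm (\<lambda>_. 0) = (0 :: 'n cmat)"
    by (simp add: vec_eq_iff)
  ultimately show ?thesis
    using has_field_derivative_mexp_nth[of "diagm (\<lambda>_. 0)" B a b] by simp
qed

subsection \<open>A Hermitian logarithm is unique\<close>

text \<open>\<open>P = exp (A/2)\<close> is positive, so it is the positive square root of the diagonal matrix \<open>exp A\<close>: a vector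
\<open>w = P e\<^sub>l - r e\<^sub>l\<close> satisfies \<open>P w = - r w\<close> with \<open>r > 0\<close> and must vanish.\<close>

lemma mexp_half_diagonal:
  fixes A :: "'n::finite cmat" and k :: "'n \<Rightarrow> real"
  assumes A: "hermitian A" and eq: "mexp A = diagm (\<lambda>a. of_real (exp (k a)))"
  shows "mexp (cscale (1/2) A) = diagm (\<lambda>a. of_real (exp (k a / 2)))"
proof -
  define P where "P = mexp (cscale (1/2) A)"
  have PP: "P ** P = diagm (\<lambda>a. of_real (exp (k a)))"
    unfolding P_def using mexp_half eq by metis
  have "P $ a $ l = diagm (\<lambda>a. of_real (exp (k a / 2))) $ a $ l" for a l
  proof -
    define r where "r = exp (k l / 2)"
    have r: "r > 0" "exp (k l) = r * r" by (simp_all add: r_def flip: exp_add)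
    define w :: "complex^'n" where "w = (\<chi> a. P $ a $ l - (if a = l then of_real r else 0))"
    have Pw: "(P *v w) $ a = - of_real r * w $ a" for a
    proof -
      have "(P *v w) $ a = (P ** P) $ a $ l - P $ a $ l * of_real r"
        by (simp add: matrix_vector_mult_def w_def matrix_mult_nth right_diff_distrib sum_subtractf
          if_distrib[of "\<lambda>x. _ * x"] cong: if_cong)
      then show ?thesis by (auto simp: PP w_def r algebra_simps)
    qed
    \<comment> \<open>\<open>Q\<close> = exp(A/4) is a Hermitian square root of \<open>P\<close>, so
      the quadratic form of \<open>P\<close> at \<open>w\<close> is nonnegative, while the
      eigenvalue equation makes it -r times the squared norm of \<open>w\<close>.\<close>
    define Q where "Q = mexp (cscale (1/2) (cscale (1/2) A))"
    have "hermitian Q"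
      unfolding Q_def by (intro hermitian_mexp hermitian_cscale A) simp_all
    moreover have "P = Q ** Q" unfolding P_def Q_def by (rule mexp_half)
    ultimately have "(\<Sum>a\<in>UNIV. cnj (w $ a) * (P *v w) $ a) = of_real (\<Sum>c\<in>UNIV. (norm ((Q *v w) $ c))\<^sup>2)"
      using hermitian_square_quadratic_form by simp
    moreover have "(\<Sum>a\<in>UNIV. cnj (w $ a) * (P *v w) $ a) = of_real (- r * (\<Sum>a\<in>UNIV. (norm (w $ a))\<^sup>2))"
      unfolding Pw of_real_mult of_real_sum of_real_minus complex_norm_square sum_distrib_left by (simp add: mult_ac)
    ultimately have "- r * (\<Sum>a\<in>UNIV. (norm (w $ a))\<^sup>2) = (\<Sum>c\<in>UNIV. (norm ((Q *v w) $ c))\<^sup>2)"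
      by (metis of_real_eq_iff)
    moreover have "(\<Sum>c\<in>UNIV. (norm ((Q *v w) $ c))\<^sup>2) \<ge> 0" "(\<Sum>a\<in>UNIV. (norm (w $ a))\<^sup>2) \<ge> 0"
      by (intro sum_nonneg; simp)+
    ultimately have "(\<Sum>a\<in>UNIV. (norm (w $ a))\<^sup>2) = 0"
      using r(1) by (smt (verit) mult_nonneg_nonneg mult_minus_left mult_pos_pos)
    then have "w $ a = 0" by (simp add: sum_nonneg_eq_0_iff)
    then show ?thesis by (auto simp: w_def r_def)
  qed
  then show ?thesis unfolding P_def by (simp add: vec_eq_iff)
qed

text \<open>Iterated halving makes \<open>exp (A/2\<^sup>n)\<close> diagonal for all \<open>n\<close>; the difference quotients at \<open>0\<close> recover \<open>A\<close>.\<close>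

lemma mexp_diagonal_imp_diagonal:
  fixes A :: "'n::finite cmat" and k :: "'n \<Rightarrow> real"
  assumes A: "hermitian A" and eq: "mexp A = diagm (\<lambda>a. of_real (exp (k a)))"
  shows "A = diagm (\<lambda>a. of_real (k a))"
proof -
  let ?D = "diagm (\<lambda>a. complex_of_real (k a))"
  have iter: "mexp (cscale (of_real (1 / 2 ^ n)) A) = mexp (cscale (of_real (1 / 2 ^ n)) ?D)" for n
  proof -
    have "cscale (of_real (1 / 2 ^ n)) ?D = diagm (\<lambda>a. of_real (k a / 2 ^ n))"
      by (simp add: vec_eq_iff)
    then have D: "mexp (cscale (of_real (1 / 2 ^ n)) ?D) = diagm (\<lambda>a. of_real (exp (k a / 2 ^ n)))"
      by (simp only: mexp_diagm exp_of_real)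
    have "mexp (cscale (of_real (1 / 2 ^ n)) A) = diagm (\<lambda>a. of_real (exp (k a / 2 ^ n)))"
    proof (induction n)
      case 0
      then show ?case using eq by (simp add: cscale_def)
    next
      case (Suc n)
      have "hermitian (cscale (of_real (1 / 2 ^ n)) A)" by (intro hermitian_cscale A) simp
      from mexp_half_diagonal[OF this Suc] show ?case by (simp add: cscale_cscale mult_ac)
    qed
    with D show ?thesis by simp
  qed
  have lim: "filterlim (\<lambda>n. complex_of_real (1 / 2 ^ n)) (at 0) sequentially"
  proof (rule filterlim_atI)
    have "(\<lambda>n. 1 / 2 ^ n) \<longlonglongrightarrow> (0::real)"
      using LIMSEQ_power_zero[of "1/2::real"] by (simp add: power_divide)
    from tendsto_of_real[OF this, where 'a = complex] show "(\<lambda>n. complex_of_real (1 / 2 ^ n)) \<longlonglongrightarrow> 0" by simp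
  qed simp
  have "A $ a $ b = ?D $ a $ b" for a b
  proof -
    have "(\<lambda>n. (mexp (cscale (of_real (1 / 2 ^ n)) B) $ a $ b - mat 1 $ a $ b) / of_real (1 / 2 ^ n))
        \<longlonglongrightarrow> B $ a $ b" for B :: "'n cmat"
      using filterlim_compose[OF has_field_derivative_mexp_cscale_nth[of B a b, unfolded has_field_derivative_iff] lim]
      by (simp only: mexp_0 diff_0_right)
    from this[of A] this[of ?D] show ?thesis
      unfolding iter by (rule LIMSEQ_unique)
  qed
  then show ?thesis by (simp add: vec_eq_iff)
qed

subsection \<open>The eigenbasis of a Gibbs state\<close>

lemma trace_conj:
  fixes U X :: "'n::finite cmat"
  assumes "U ** V = mat 1"
  shows "trace (V ** X ** U) = trace X"
proof -
  have "trace (V ** X ** U) = trace (U ** (V ** X))" by (rule trace_mul_sym)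
  then show ?thesis by (simp add: matrix_mul_assoc assms)
qed

lemma spectral_decomp_matrix:
  fixes v :: "'n::finite \<Rightarrow> complex^'n"
  defines "U \<equiv> (\<chi> a k. v k $ a)"
  assumes "spectral_decomp \<sigma> v lam"
  shows "\<sigma> = U ** diagm (\<lambda>k. of_real (lam k)) ** cadj U" "cadj U ** U = mat 1"
proof -
  have "(U ** diagm (\<lambda>k. of_real (lam k)) ** cadj U) $ a $ b =
      (\<Sum>k\<in>UNIV. of_real (lam k) * (v k $ a * cnj (v k $ b)))" for a b
    unfolding matrix_mult_nth[of "U ** _"] by (simp add: U_def mult_ac)
  then show "\<sigma> = U ** diagm (\<lambda>k. of_real (lam k)) ** cadj U"
    using assms(2) by (simp add: spectral_decomp_def vec_eq_iff)
  have "(cadj U ** U) $ k $ l = braket (v k) (mat 1) (v l)" for k l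
    by (simp add: braket_def U_def matrix_mult_nth)
  then show "cadj U ** U = mat 1"
    using assms(2) by (simp add: spectral_decomp_def vec_eq_iff mat_nth)
qed

text \<open>Conjugation by \<open>U\<close> makes exp(-H) diagonal with entries
  \<open>z * lam k\<close>; uniqueness of the Hermitian logarithm then makes -H diagonal in the same
  basis, even when eigenvalues coincide.\<close>

lemma gibbs_eigenbasis:
  fixes H :: "'n::finite cmat" and v :: "'n \<Rightarrow> complex^'n"
  defines "U \<equiv> (\<chi> a k. v k $ a)"
  assumes H: "hermitian H"
    and spec: "spectral_decomp (cscale (1 / trace (mexp (- H))) (mexp (- H))) v lam"
  obtains h z where "z > 0" "trace (mexp (- H)) = of_real z" "cadj U ** U = mat 1" "U ** cadj U = mat 1"
    "H = U ** diagm (\<lambda>k. of_real (h k)) ** cadj U" "\<And>k. lam k = exp (- h k) / z"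
proof -
  let ?E = "mexp (- H)"
  have hE: "hermitian (- H)"
    using hermitian_cscale[OF H, of "- 1"] by (simp add: cscale_def vec_eq_iff hermitian_def)
  have UU: "cadj U ** U = mat 1"
    unfolding U_def by (rule spectral_decomp_matrix[OF spec])
  then have UU': "U ** cadj U = mat 1" by (simp add: matrix_left_right_inverse)
  have "\<exists>r>0. ?E $ a $ a = of_real r" for a
    using mexp_diagonal_pos[OF hE] by metis
  then obtain r where r: "r a > 0" "?E $ a $ a = complex_of_real (r a)" for a by metis
  define z where "z = (\<Sum>a\<in>UNIV. r a)"
  have z: "z > 0" "trace ?E = of_real z"
    unfolding z_def using r by (auto simp: trace_def intro: sum_pos)
  have "cscale (1 / trace ?E) ?E = U ** diagm (\<lambda>k. of_real (lam k)) ** cadj U"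
    unfolding U_def by (rule spectral_decomp_matrix[OF spec])
  then have "cadj U ** cscale (1 / trace ?E) ?E ** U = cadj U ** U ** diagm (\<lambda>k. of_real (lam k)) ** (cadj U ** U)"
    by (simp add: matrix_mul_assoc)
  then have "cscale (1 / of_real z) (cadj U ** ?E ** U) = diagm (\<lambda>k. of_real (lam k))"
    by (simp add: UU z cscale_mult_left cscale_mult_right)
  then have "cscale (of_real z) (cscale (1 / of_real z) (cadj U ** ?E ** U)) = cscale (of_real z) (diagm (\<lambda>k. of_real (lam k)))"
    by simp
  then have conjE: "cadj U ** ?E ** U = diagm (\<lambda>k. of_real (z * lam k))"
    using z by (simp add: cscale_cscale vec_eq_iff)
  define A where "A = cadj U ** (- H) ** U"
  have A: "hermitian A"
    using hE unfolding A_def hermitian_def by (simp add: cadj_mult matrix_mul_assoc)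
  have mA: "mexp A = diagm (\<lambda>k. of_real (z * lam k))"
    unfolding A_def mexp_conj[OF UU UU'] by (rule conjE)
  \<comment> \<open>Positivity, needed for the logarithm below, is read off the diagonal of a
    Hermitian exponential.\<close>
  have pos: "z * lam k > 0" for k
  proof -
    obtain r where "r > 0" "mexp A $ k $ k = of_real r" by (rule mexp_diagonal_pos[OF A])
    then show ?thesis unfolding mA by (simp flip: of_real_mult)
  qed
  define h where "h k = - ln (z * lam k)" for k
  have "mexp A = diagm (\<lambda>k. of_real (exp (- h k)))"
    unfolding mA h_def using pos by simp
  from mexp_diagonal_imp_diagonal[OF A this]
  have Ah: "A = diagm (\<lambda>k. of_real (- h k))" .
  have "H = U ** cadj U ** H ** (U ** cadj U)" by (simp add: UU')
  also have "\<dots> = U ** (- A) ** cadj U"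
  proof -
    have "- A = cadj U ** H ** U"
      unfolding A_def using linear_neg[OF linear_conj, of "cadj U" H U] by simp
    then show ?thesis by (simp add: matrix_mul_assoc)
  qed
  also have "- A = diagm (\<lambda>k. of_real (h k))"
    unfolding Ah by (simp add: vec_eq_iff)
  finally have "H = U ** diagm (\<lambda>k. of_real (h k)) ** cadj U" .
  moreover have "lam k = exp (- h k) / z" for k
    using pos[of k] z by (simp add: h_def)
  ultimately show thesis using that z UU UU' by blast
qed

text \<open>In the eigenbasis the evolution multiplies entry (k, l) by the phase exp(-i (h k - h l)
  t), and averaging that phase against the tent density gives its transform.\<close>

lemma Phi_eigenbasis:
  fixes G :: "'j::finite \<Rightarrow> 'n::finite cmat"
  assumes U: "cadj U ** U = mat 1" "U ** cadj U = mat 1"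
    and H: "Gen G \<theta> = U ** diagm (\<lambda>k. of_real (h k)) ** cadj U"
  shows "(cadj U ** Phi G \<theta> X ** U) $ k $ l = (cadj U ** X ** U) $ k $ l * of_real (tent_transform (h k - h l))"
proof -
  define Y where "Y = cadj U ** X ** U"
  define T where "T = (\<chi> k l. Y $ k $ l * complex_of_real (tent_transform (h k - h l)))"
  have expH: "mexp (cscale c (Gen G \<theta>)) = U ** diagm (\<lambda>k. exp (c * of_real (h k))) ** cadj U" for c
  proof -
    have "cscale c (Gen G \<theta>) = U ** cscale c (diagm (\<lambda>k. of_real (h k))) ** cadj U"
      unfolding H by (simp add: cscale_mult_left cscale_mult_right)
    also have "cscale c (diagm (\<lambda>k. of_real (h k))) = diagm (\<lambda>k. c * of_real (h k))"
      by (simp add: vec_eq_iff)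
    finally show ?thesis by (simp add: mexp_conj[OF U(2,1)] mexp_diagm)
  qed
  have "Phi G \<theta> X $ a $ b = (U ** T ** cadj U) $ a $ b" for a b
  proof -
    let ?e = "\<lambda>c. diagm (\<lambda>k. exp (c * complex_of_real (h k)))"
    \<comment> \<open>A standard-basis entry is a finite combination of such phases with
      coefficients independent of \<open>t\<close>, so the integral passes through the sums.\<close>
    have "of_real (tent t) * (mexp (cscale (- \<i> * of_real t) (Gen G \<theta>)) ** X **
        mexp (cscale (\<i> * of_real t) (Gen G \<theta>))) $ a $ b =
        (\<Sum>l\<in>UNIV. \<Sum>k\<in>UNIV. (U $ a $ k * Y $ k $ l * cadj U $ l $ b) *
          (of_real (tent t) * exp (- \<i> * of_real ((h k - h l) * t))))" for t
    proof -
      have "mexp (cscale (- \<i> * of_real t) (Gen G \<theta>)) ** X ** mexp (cscale (\<i> * of_real t) (Gen G \<theta>)) =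
          U ** (?e (- \<i> * of_real t) ** Y ** ?e (\<i> * of_real t)) ** cadj U"
        unfolding expH Y_def by (simp only: matrix_mul_assoc)
      moreover have "(?e (- \<i> * of_real t) ** Y ** ?e (\<i> * of_real t)) $ k $ l =
          Y $ k $ l * exp (- \<i> * of_real ((h k - h l) * t))" for k l
      proof -
        have "exp (- \<i> * of_real ((h k - h l) * t)) =
            exp (- \<i> * of_real t * of_real (h k)) * exp (\<i> * of_real t * of_real (h l))"
          by (simp add: algebra_simps flip: exp_add)
        then show ?thesis by simp
      qed
      ultimately show ?thesis
        by (simp only: matrix_mult_nth[of "U ** _"] matrix_mult_nth[of U] sum_distrib_left sum_distrib_right mult_ac)
    qed
    then have "Phi G \<theta> X $ a $ b = (\<integral>t. (\<Sum>l\<in>UNIV. \<Sum>k\<in>UNIV. (U $ a $ k * Y $ k $ l * cadj U $ l $ b) *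
          (of_real (tent t) * exp (- \<i> * of_real ((h k - h l) * t)))) \<partial>lborel)"
      by (simp add: Phi_def)
    also have "\<dots> = (\<Sum>l\<in>UNIV. \<Sum>k\<in>UNIV. (U $ a $ k * Y $ k $ l * cadj U $ l $ b) * of_real (tent_transform (h k - h l)))"
      by (intro has_bochner_integral_integral_eq has_bochner_integral_sum has_bochner_integral_mult_right
          has_bochner_integral_tent)
    also have "\<dots> = (U ** T ** cadj U) $ a $ b"
      by (simp add: matrix_mult_nth[of "U ** _"] matrix_mult_nth[of U] T_def sum_distrib_left sum_distrib_right mult_ac)
    finally show ?thesis .
  qed
  then have "Phi G \<theta> X = U ** T ** cadj U" by (simp add: vec_eq_iff)
  then have "cadj U ** Phi G \<theta> X ** U = cadj U ** U ** T ** (cadj U ** U)"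
    by (simp only: matrix_mul_assoc)
  then have "cadj U ** Phi G \<theta> X ** U = T" by (simp add: U)
  then show ?thesis by (simp add: T_def Y_def)
qed

section \<open>Derivative of the Gibbs state and the Fisher-Bures sum\<close>

lemma Gen_add_axis: "Gen G (\<theta> + s *\<^sub>R axis i 1) = Gen G \<theta> + cscale (of_real s) (G i)"
proof -
  have "of_real (s * axis i 1 $ j) * x = (if j = i then of_real s * x else 0)" for j and x :: complex
    by (simp add: axis_def)
  then show ?thesis
    by (simp add: Gen_def vec_eq_iff distrib_right sum.distrib del: of_real_mult)
qed

lemma pderiv_mat_gibbs:
  fixes G :: "'j::finite \<Rightarrow> 'n::finite cmat" and \<theta> :: "real^'j" and i :: 'j
  defines "E \<equiv> mexp (- Gen G \<theta>)" and "D \<equiv> dmexp (- Gen G \<theta>) (- G i)"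
  assumes "trace E \<noteq> 0"
  shows "pderiv_mat (gibbs G) i \<theta> = cscale (1 / trace E) D - cscale (trace D / (trace E)\<^sup>2) E"
proof -
  \<comment> \<open>The parameter is complex so that field derivatives and the quotient rule apply;
    it is restricted to the real line afterwards.\<close>
  define F where "F s = mexp (- Gen G \<theta> + cscale s (- G i))" for s
  have F0: "F 0 = E" by (simp add: F_def E_def cscale_def zero_vec_def[symmetric])
  have F: "((\<lambda>s. F s $ a $ b) has_field_derivative D $ a $ b) (at 0)" for a b
    unfolding F_def D_def by (rule has_field_derivative_mexp_nth)
  have trF: "((\<lambda>s. trace (F s)) has_field_derivative trace D) (at 0)"
    unfolding trace_def by (intro DERIV_sum F)
  have "vector_derivative (\<lambda>s. gibbs G (\<theta> + s *\<^sub>R axis i 1) $ a $ b) (at 0) =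
      D $ a $ b / trace E - trace D / (trace E)\<^sup>2 * E $ a $ b" for a b
  proof (rule vector_derivative_at)
    have "((\<lambda>s. F s $ a $ b / trace (F s)) has_field_derivative
        (D $ a $ b * trace (F 0) - F 0 $ a $ b * trace D) / (trace (F 0) * trace (F 0))) (at 0)"
      by (rule DERIV_divide[OF F trF]) (use assms in \<open>simp add: F0\<close>)
    also have "(D $ a $ b * trace (F 0) - F 0 $ a $ b * trace D) / (trace (F 0) * trace (F 0)) =
        D $ a $ b / trace E - trace D / (trace E)\<^sup>2 * E $ a $ b"
      unfolding F0 using assms by (simp add: field_simps power2_eq_square)
    finally have "((\<lambda>s. F (of_real s) $ a $ b / trace (F (of_real s))) has_vector_derivative
        D $ a $ b / trace E - trace D / (trace E)\<^sup>2 * E $ a $ b) (at 0)"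
      using has_vector_derivative_real_field[of "\<lambda>s. F s $ a $ b / trace (F s)" _ 0 UNIV] by simp
    moreover have "gibbs G (\<theta> + s *\<^sub>R axis i 1) $ a $ b = F (of_real s) $ a $ b / trace (F (of_real s))" for s
    proof -
      have "- Gen G (\<theta> + s *\<^sub>R axis i 1) = - Gen G \<theta> + cscale (of_real s) (- G i)"
        by (simp add: Gen_add_axis vec_eq_iff)
      then show ?thesis by (simp add: gibbs_def F_def)
    qed
    ultimately show "((\<lambda>s. gibbs G (\<theta> + s *\<^sub>R axis i 1) $ a $ b) has_vector_derivative
        D $ a $ b / trace E - trace D / (trace E)\<^sup>2 * E $ a $ b) (at 0)"
      by simp
  qed
  then show ?thesis by (simp add: pderiv_mat_def vec_eq_iff)
qed

text \<open>The derivative of the unnormalised exponential produces divided differences, which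
  \<open>tent_transform_mult_exp_sum\<close> converts into arithmetic means times entries of the
  channel output. Differentiating the normalisation adds the diagonal term.\<close>

lemma pderiv_gibbs_eigenbasis:
  fixes G :: "'j::finite \<Rightarrow> 'n::finite cmat"
  assumes U: "cadj U ** U = mat 1" "U ** cadj U = mat 1"
    and H: "Gen G \<theta> = U ** diagm (\<lambda>k. of_real (h k)) ** cadj U"
    and z: "z > 0" "trace (mexp (- Gen G \<theta>)) = of_real z"
    and lam: "\<And>k. lam k = exp (- h k) / z"
  shows "(cadj U ** pderiv_mat (gibbs G) i \<theta> ** U) $ k $ l =
    - (of_real ((lam k + lam l) / 2) * (cadj U ** Phi G \<theta> (G i) ** U) $ k $ l) +
    (if k = l then of_real (lam k) * (\<Sum>m\<in>UNIV. of_real (lam m) * (cadj U ** G i ** U) $ m $ m) else 0)"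
proof -
  let ?H = "Gen G \<theta>"
  let ?E = "mexp (- ?H)" and ?D = "dmexp (- ?H) (- G i)"
  define g where "g = cadj U ** G i ** U"
  define d where "d = (\<lambda>k. complex_of_real (- h k))"
  have "cadj U ** (- ?H) ** U = - (cadj U ** U ** diagm (\<lambda>k. of_real (h k)) ** (cadj U ** U))"
    unfolding H linear_neg[OF linear_conj] by (simp only: matrix_mul_assoc)
  also have "\<dots> = diagm d" by (simp add: U vec_eq_iff d_def)
  finally have conjH: "cadj U ** (- ?H) ** U = diagm d" .
  have conjE: "cadj U ** ?E ** U = diagm (\<lambda>k. of_real (z * lam k))"
    unfolding mexp_conj[OF U, symmetric] conjH mexp_diagm d_def exp_of_real lam using z by simp
  have conjD: "cadj U ** ?D ** U = dmexp (diagm d) (- g)"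
    unfolding dmexp_conj[OF U, symmetric] conjH unfolding linear_neg[OF linear_conj] g_def ..
  have D_nth: "(cadj U ** ?D ** U) $ k $ l = - (of_real (z * ((lam k + lam l) / 2) * tent_transform (h k - h l)) * g $ k $ l)" for k l
  proof -
    have "z * ((lam k + lam l) / 2) * tent_transform (h k - h l) =
        (exp (- h k) + exp (- h l)) / 2 * tent_transform (h k - h l)"
      using z by (simp add: lam add_divide_distrib distrib_left)
    also have "\<dots> = (if h k = h l then exp (- h k) else (exp (- h l) - exp (- h k)) / (h k - h l))"
      by (rule tent_transform_mult_exp_sum)
    finally have eq: "z * ((lam k + lam l) / 2) * tent_transform (h k - h l) = \<dots>" .
    have "complex_of_real (if h k = h l then exp (- h k) else (exp (- h l) - exp (- h k)) / (h k - h l)) =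
        (if d k = d l then exp (d k) else (exp (d k) - exp (d l)) / (d k - d l))"
    proof (cases "h k = h l")
      case False
      have "(exp (- h l) - exp (- h k)) / (h k - h l) = (exp (- h k) - exp (- h l)) / (- h k - - h l)"
        by (subst minus_divide_divide[symmetric]) simp
      then show ?thesis using False unfolding d_def exp_of_real of_real_eq_iff by simp
    qed (simp add: d_def flip: exp_of_real)
    then show ?thesis unfolding eq conjD dmexp_diagm_nth by simp
  qed
  \<comment> \<open>Only diagonal entries enter, where the transform is 1.\<close>
  have trD: "trace ?D = - of_real z * (\<Sum>m\<in>UNIV. of_real (lam m) * g $ m $ m)"
  proof -
    have "trace ?D = trace (cadj U ** ?D ** U)" by (rule trace_conj[symmetric, OF U(2)])
    then show ?thesis
      unfolding trace_def D_nth by (simp add: tent_transform_def sum_distrib_left sum_negf mult.assoc)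
  qed
  have "cadj U ** pderiv_mat (gibbs G) i \<theta> ** U =
      cscale (1 / trace ?E) (cadj U ** ?D ** U) - cscale (trace ?D / (trace ?E)\<^sup>2) (cadj U ** ?E ** U)"
    using z by (subst pderiv_mat_gibbs)
      (simp_all add: linear_diff[OF linear_conj] cscale_mult_left cscale_mult_right)
  then have "(cadj U ** pderiv_mat (gibbs G) i \<theta> ** U) $ k $ l =
      (cadj U ** ?D ** U) $ k $ l / of_real z - trace ?D / (of_real z)\<^sup>2 * (cadj U ** ?E ** U) $ k $ l"
    by (simp add: z)
  also have "\<dots> = - (of_real ((lam k + lam l) / 2) * (g $ k $ l * of_real (tent_transform (h k - h l)))) +
    (if k = l then of_real (lam k) * (\<Sum>m\<in>UNIV. of_real (lam m) * g $ m $ m) else 0)"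
    unfolding D_nth trD conjE using z by (simp add: power2_eq_square)
  finally show ?thesis
    unfolding g_def Phi_eigenbasis[OF U H] .
qed

text \<open>The weight 2 / (lam k + lam l) cancels one of the two means. The remaining corrections
  sit on the diagonal and sum to m m' - m m' - m' m = -m m', using that the weights
  \<open>lam k\<close> add up to 1.\<close>

lemma Fisher_Bures_sum:
  fixes lam :: "'n::finite \<Rightarrow> real" and f g :: "'n \<Rightarrow> 'n \<Rightarrow> complex"
  assumes pos: "\<And>k. lam k > 0" and sum1: "(\<Sum>k\<in>UNIV. lam k) = 1"
    and m: "m = (\<Sum>k\<in>UNIV. of_real (lam k) * f k k)" and m': "m' = (\<Sum>k\<in>UNIV. of_real (lam k) * g k k)"
  shows "(\<Sum>k\<in>UNIV. \<Sum>l\<in>UNIV. of_real (2 / (lam k + lam l)) *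
      (- (of_real ((lam k + lam l) / 2) * f k l) + (if k = l then of_real (lam k) * m else 0)) *
      (- (of_real ((lam l + lam k) / 2) * g l k) + (if l = k then of_real (lam l) * m' else 0))) =
    (\<Sum>k\<in>UNIV. \<Sum>l\<in>UNIV. of_real ((lam k + lam l) / 2) * f k l * g l k) - m * m'"
proof -
  have "of_real (2 / (lam k + lam l)) *
      (- (of_real ((lam k + lam l) / 2) * f k l) + (if k = l then of_real (lam k) * m else 0)) *
      (- (of_real ((lam l + lam k) / 2) * g l k) + (if l = k then of_real (lam l) * m' else 0)) =
    of_real ((lam k + lam l) / 2) * f k l * g l k +
    (if k = l then of_real (lam k) * m * m' - of_real (lam k) * f k k * m' - of_real (lam k) * g k k * m else 0)"
    for k l
  proof -
    define s where "s = complex_of_real ((lam k + lam l) / 2)"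
    have "(lam k + lam l) / 2 \<noteq> 0" using pos[of k] pos[of l] by simp
    then have s: "s \<noteq> 0" unfolding s_def of_real_eq_0_iff .
    have "complex_of_real (2 / (lam k + lam l)) = of_real (1 / ((lam k + lam l) / 2))" by simp
    then have inv: "complex_of_real (2 / (lam k + lam l)) = 1 / s"
      unfolding s_def by (simp only: of_real_divide of_real_1)
    have sym: "complex_of_real ((lam l + lam k) / 2) = s" by (simp add: s_def add.commute)
    have "of_real (lam k) = s" if "k = l" using that by (simp add: s_def)
    then show ?thesis
      unfolding inv sym s_def[symmetric] using s by (auto simp: field_simps)
  qed
  moreover have "(\<Sum>k\<in>UNIV. of_real (lam k) * m * m' - of_real (lam k) * f k k * m' - of_real (lam k) * g k k * m) = - (m * m')"
  proof -
    have "(\<Sum>k\<in>UNIV. of_real (lam k) * m * m' - of_real (lam k) * f k k * m' - of_real (lam k) * g k k * m) =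
        of_real (\<Sum>k\<in>UNIV. lam k) * m * m' - m * m' - m' * m"
      unfolding m[symmetric] sum_subtractf sum_distrib_right[symmetric] m'[symmetric] by simp
    then show ?thesis by (simp add: sum1)
  qed
  ultimately show ?thesis by (simp add: sum.distrib)
qed

theorem theorem1:
  fixes G :: "'j::finite \<Rightarrow> complex^'n::finite^'n"
    and \<theta> :: "real^'j"
    and v :: "'n \<Rightarrow> complex^'n" and lam :: "'n \<Rightarrow> real"
    and i j :: 'j
  assumes herm: "\<And>k. hermitian (G k)"
    and spec: "spectral_decomp (gibbs G \<theta>) v lam"
  shows "FB_info (gibbs G) \<theta> v lam i j =
           1/2 * trace ((Phi G \<theta> (G i) ** Phi G \<theta> (G j) + Phi G \<theta> (G j) ** Phi G \<theta> (G i))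
                        ** gibbs G \<theta>)
           - trace (G i ** gibbs G \<theta>) * trace (G j ** gibbs G \<theta>)
       \<and> FB_info (gibbs G) \<theta> v lam i j =
           complex_of_real (Re (trace (Phi G \<theta> (G i) ** gibbs G \<theta> ** Phi G \<theta> (G j))))
           - trace (G i ** gibbs G \<theta>) * trace (G j ** gibbs G \<theta>)"
proof -
  define U where "U = (\<chi> a k. v k $ a)"
  have "hermitian (Gen G \<theta>)"
    using hermitian_nth[OF herm] by (simp add: hermitian_def Gen_def vec_eq_iff)
  from gibbs_eigenbasis[OF this spec[unfolded gibbs_def], folded U_def]
  obtain h z where z: "z > 0" "trace (mexp (- Gen G \<theta>)) = complex_of_real z"
    and U: "cadj U ** U = mat 1" "U ** cadj U = mat 1"
    and H: "Gen G \<theta> = U ** diagm (\<lambda>k. of_real (h k)) ** cadj U"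
    and lam: "\<And>k. lam k = exp (- h k) / z"
    by blast
  \<comment> \<open>Passage to the eigenbasis: multiplicative, trace-preserving, and taking the
    Gibbs state to a diagonal matrix.\<close>
  define R where "R X = cadj U ** X ** U" for X
  have R_mult: "R (X ** Y) = R X ** R Y" for X Y
  proof -
    have "R X ** R Y = cadj U ** X ** (U ** cadj U) ** Y ** U"
      unfolding R_def by (simp only: matrix_mul_assoc)
    then show ?thesis by (simp add: U R_def matrix_mul_assoc)
  qed
  have R_trace: "trace X = trace (R X)" for X
    unfolding R_def by (rule trace_conj[OF U(2), symmetric])
  have R_gibbs: "R (gibbs G \<theta>) = diagm (\<lambda>k. of_real (lam k))"
  proof -
    have "gibbs G \<theta> = U ** diagm (\<lambda>k. of_real (lam k)) ** cadj U"
      unfolding U_def by (rule spectral_decomp_matrix[OF spec])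
    then have "R (gibbs G \<theta>) = cadj U ** U ** diagm (\<lambda>k. of_real (lam k)) ** (cadj U ** U)"
      by (simp add: R_def matrix_mul_assoc)
    then show ?thesis by (simp add: U)
  qed
  have R_braket: "braket (v k) X (v l) = R X $ k $ l" for k l X
    by (simp add: braket_def R_def U_def matrix_mult_nth matrix_vector_mult_def sum_distrib_left
      sum_distrib_right mult_ac) (rule sum.swap)
  define \<phi> where "\<phi> i = R (Phi G \<theta> (G i))" for i
  have pos: "lam k > 0" for k using z by (simp add: lam)
  have sum1: "(\<Sum>k\<in>UNIV. lam k) = 1"
  proof -
    have "trace (gibbs G \<theta>) = 1"
      using z by (simp add: gibbs_def trace_def flip: sum_divide_distrib)
    then have "complex_of_real (\<Sum>k\<in>UNIV. lam k) = 1"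
      unfolding R_trace[of "gibbs G \<theta>"] R_gibbs by (simp add: trace_def)
    then show ?thesis by (simp only: of_real_eq_1_iff)
  qed
  have \<phi>_nth: "\<phi> i $ k $ l = R (G i) $ k $ l * of_real (tent_transform (h k - h l))" for i k l
    unfolding \<phi>_def R_def by (rule Phi_eigenbasis[OF U H])
  \<comment> \<open>The channel fixes diagonal entries in the eigenbasis, so the expectation can be
    written with \<phi>, as the Fisher-Bures sum needs, or with \<open>R (G i)\<close>, as in the
    derivative formula.\<close>
  have mean: "trace (G i ** gibbs G \<theta>) = (\<Sum>k\<in>UNIV. of_real (lam k) * \<phi> i $ k $ k)" for i
    unfolding R_trace[of "G i ** gibbs G \<theta>"] R_mult R_gibbs by (simp add: trace_def \<phi>_nth tent_transform_def mult.commute)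
  have mean': "trace (G i ** gibbs G \<theta>) = (\<Sum>k\<in>UNIV. of_real (lam k) * R (G i) $ k $ k)" for i
    unfolding R_trace[of "G i ** gibbs G \<theta>"] R_mult R_gibbs by (simp add: trace_def mult.commute)
  have pderiv: "R (pderiv_mat (gibbs G) i \<theta>) $ k $ l =
    - (of_real ((lam k + lam l) / 2) * \<phi> i $ k $ l) +
      (if k = l then of_real (lam k) * trace (G i ** gibbs G \<theta>) else 0)" for i k l
    unfolding mean' \<phi>_def R_def by (rule pderiv_gibbs_eigenbasis[OF U H z lam])
  have FB: "FB_info (gibbs G) \<theta> v lam i j =
      (\<Sum>k\<in>UNIV. \<Sum>l\<in>UNIV. of_real ((lam k + lam l) / 2) * \<phi> i $ k $ l * \<phi> j $ l $ k)
      - trace (G i ** gibbs G \<theta>) * trace (G j ** gibbs G \<theta>)"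
    unfolding FB_info_def R_braket pderiv
    by (rule Fisher_Bures_sum[where f = "\<lambda>k l. \<phi> i $ k $ l" and g = "\<lambda>k l. \<phi> j $ k $ l",
        OF pos sum1 mean mean])
  \<comment> \<open>The weight \<open>lam k\<close> gives one operator order in the anticommutator,
    and \<open>lam l\<close> the other.\<close>
  have split: "(\<Sum>k\<in>UNIV. \<Sum>l\<in>UNIV. of_real ((lam k + lam l) / 2) * \<phi> i $ k $ l * \<phi> j $ l $ k) =
      1/2 * ((\<Sum>k\<in>UNIV. \<Sum>l\<in>UNIV. of_real (lam k) * \<phi> i $ k $ l * \<phi> j $ l $ k) +
        (\<Sum>k\<in>UNIV. \<Sum>l\<in>UNIV. of_real (lam l) * \<phi> i $ k $ l * \<phi> j $ l $ k))"
    by (simp add: sum.distrib[symmetric] sum_distrib_left add_divide_distrib distrib_right)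
  have tr1: "trace (Phi G \<theta> (G i) ** Phi G \<theta> (G j) ** gibbs G \<theta>) =
      (\<Sum>k\<in>UNIV. \<Sum>l\<in>UNIV. of_real (lam k) * \<phi> i $ k $ l * \<phi> j $ l $ k)" for i j
    unfolding R_trace[of "_ ** gibbs G \<theta>"] R_mult R_gibbs \<phi>_def[symmetric]
    by (simp add: trace_def matrix_mult_nth[of "\<phi> _"] sum_distrib_left mult_ac)
  have swap: "(\<Sum>k\<in>UNIV. \<Sum>l\<in>UNIV. of_real (lam k) * \<phi> j $ k $ l * \<phi> i $ l $ k) =
      (\<Sum>k\<in>UNIV. \<Sum>l\<in>UNIV. of_real (lam l) * \<phi> i $ k $ l * \<phi> j $ l $ k)" for i j
    by (subst sum.swap) (simp add: mult_ac)
  have first: "(\<Sum>k\<in>UNIV. \<Sum>l\<in>UNIV. of_real ((lam k + lam l) / 2) * \<phi> i $ k $ l * \<phi> j $ l $ k) =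
      1/2 * trace ((Phi G \<theta> (G i) ** Phi G \<theta> (G j) + Phi G \<theta> (G j) ** Phi G \<theta> (G i)) ** gibbs G \<theta>)"
  proof -
    have "(X + Y) ** W = X ** W + Y ** W" for X Y W :: "'n cmat"
      by (simp add: vec_eq_iff matrix_mult_nth distrib_right sum.distrib)
    then show ?thesis unfolding split by (simp add: trace_add tr1 swap)
  qed
  have second: "(\<Sum>k\<in>UNIV. \<Sum>l\<in>UNIV. of_real ((lam k + lam l) / 2) * \<phi> i $ k $ l * \<phi> j $ l $ k) =
      of_real (Re (trace (Phi G \<theta> (G i) ** gibbs G \<theta> ** Phi G \<theta> (G j))))"
  proof -
    \<comment> \<open>The transform is real and even, so \<phi> inherits hermiticity from
      \<open>G i\<close>. The two halves of \<open>split\<close> are then complex conjugates and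
      their average is a real part.\<close>
    have cnj_\<phi>: "cnj (\<phi> i $ k $ l) = \<phi> i $ l $ k" for i k l
    proof -
      have "hermitian (R (G i))"
        using herm unfolding hermitian_def R_def by (simp add: cadj_mult matrix_mul_assoc)
      then show ?thesis
        using tent_transform_minus[of "h k - h l"] by (simp add: \<phi>_nth hermitian_nth)
    qed
    define S where "S = (\<Sum>k\<in>UNIV. \<Sum>l\<in>UNIV. of_real (lam l) * \<phi> i $ k $ l * \<phi> j $ l $ k)"
    have "trace (Phi G \<theta> (G i) ** gibbs G \<theta> ** Phi G \<theta> (G j)) = S"
      unfolding R_trace[of "_ ** Phi G \<theta> (G j)"] R_mult R_gibbs \<phi>_def[symmetric] S_def
      by (simp add: trace_def matrix_mult_nth[of "_ ** diagm _"] mult_ac)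
    moreover have "(\<Sum>k\<in>UNIV. \<Sum>l\<in>UNIV. of_real (lam k) * \<phi> i $ k $ l * \<phi> j $ l $ k) = cnj S"
      unfolding S_def by (subst sum.swap) (simp add: cnj_\<phi>)
    ultimately show ?thesis
      unfolding split S_def[symmetric] by (simp add: complex_eq_iff)
  qed
  show ?thesis using FB first second by simp
qed

end
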